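(* Let $G$ be a three-dimensional non-unimodular Lie group. Its Lie algebra $\mathfrak g$ is isomorphic to a semidirect product of $\mathbb R$ and $\mathbb R^2$, with $\mathbb R$ acting on $\mathbb R^2$ by a real $2\times2$ matrix $M$ (of non-zero trace). Then there exists a generalized Einstein structure $(H,\mathcal G_g,\delta)$ on $G$ such that the restriction of $g$ to the unimodular kernel $\mathfrak u$ is degenerate if and only if $M$ has real eigenvalues; moreover every such structure has $H=0$ and $\delta\neq0$.
   Context: The unimodular kernel is $\mathfrak u=\{X\in\mathfrak g:\mathrm{tr}\,\mathrm{ad}_X=0\}$; $G$ is called non-unimodular here if $\mathfrak u\neq\mathfrak g$. Left-invariant tensors are identified with tensors on $\mathfrak g$; $g$ is a left-invariant pseudo-Riemannian metric and $H\in\bigwedge^3\mathfrak g^*$. Let $E=\mathfrak g\oplus\mathfrak g^*$, with scalar product $\langle X+\xi,Y+\eta\rangle=\frac12(\xi(Y)+\eta(X))$ and Dorfman bracket $[X+\xi,Y+\eta]_H=[X,Y]-\mathrm{ad}_X^*\eta+\mathrm{ad}_Y^*\xi+H(X,Y,\cdot)$, where $\mathrm{ad}_X^*\eta=\eta\circ\mathrm{ad}_X$. Put $gX=g(X,\cdot)$, $\mathcal G_g(X+\xi,Y+\eta)=\frac12(g(X,Y)+g^{-1}(\xi,\eta))$ and $E_\pm=\{X\pm gX:X\in\mathfrak g\}$. A left-invariant generalized connection is a linear map $D:E\to\mathfrak{so}(E)$, $u\mapsto D_u$. Its torsion is $T(u,v)=D_uv-D_vu-[u,v]_H+(Du)^*v$,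 where $Du$ is $w\mapsto D_wu$ and $*$ is the adjoint for $\langle\cdot,\cdot\rangle$. $D$ is Levi-Civita if $T=0$ and $D_uE_\pm\subset E_\pm$ for all $u$. Its divergence is $\delta_D(v)=\mathrm{tr}(u\mapsto D_uv)$. Given $\delta\in E^*$, choose a Levi-Civita $D$ with $\delta_D=\delta$ (one exists), put $R(u,v)w=D_uD_vw-D_vD_uw-D_{[u,v]_H}w$ and, for $u_\pm\in E_\pm$, $Ric^+_\delta(u_-,u_+)=\mathrm{tr}(E_+\ni w\mapsto R(w,u_-)u_+\in E_+)$, $Ric^-_\delta(u_+,u_-)=\mathrm{tr}(E_-\ni w\mapsto R(w,u_+)u_-\in E_-)$; these are known to be independent of the choice of $D$. $(H,\mathcal G_g,\delta)$ is a generalized Einstein structure if $Ric^+_\delta=0$ and $Ric^-_\delta=0$. *)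

theory Defs
  imports "HOL-Analysis.Analysis"
begin

text \<open>
  All structures are left-invariant, so they are given on the Lie algebra. The Lie algebra is a
  real vector space \<open>'a\<close> of class \<^class>\<open>euclidean_space\<close> with a bracket \<open>br\<close>; the class only
  provides finite dimension, its inner product is never used.  Linear maps between finite
  dimensional spaces are bounded, so \<open>'a \<Rightarrow>\<^sub>L real\<close> is the full dual space and \<open>Blinfun\<close>
  turns any linear form into an element of it.
\<close>

section \<open>Lie algebras\<close>

definition lie_bracket :: "('a::real_vector \<Rightarrow> 'a \<Rightarrow> 'a) \<Rightarrow> bool" where
  "lie_bracket br \<longleftrightarrow> bilinear br \<and> (\<forall>X. br X X = 0) \<and>
     (\<forall>X Y Z. br X (br Y Z) + br Y (br Z X) + br Z (br X Y) = 0)"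

text \<open>Trace of \<open>f\<close> restricted to a finite-dimensional subspace \<open>S\<close> that \<open>f\<close> maps into itself;
  it does not depend on the chosen basis.\<close>

definition trace_on :: "'v::real_vector set \<Rightarrow> ('v \<Rightarrow> 'v) \<Rightarrow> real" where
  "trace_on S f = (let B = (SOME B. independent B \<and> span B = S)
                   in \<Sum>b\<in>B. representation B (f b) b)"

definition unimodular_kernel :: "('a::real_vector \<Rightarrow> 'a \<Rightarrow> 'a) \<Rightarrow> 'a set" where
  "unimodular_kernel br = {X. trace_on UNIV (br X) = 0}"

definition lie_isomorphic ::
    "('a::real_vector \<Rightarrow> 'a \<Rightarrow> 'a) \<Rightarrow> ('b::real_vector \<Rightarrow> 'b \<Rightarrow> 'b) \<Rightarrow> bool" where
  "lie_isomorphic br br' \<longleftrightarrow>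
     (\<exists>\<phi>. linear \<phi> \<and> bij \<phi> \<and> (\<forall>X Y. \<phi> (br X Y) = br' (\<phi> X) (\<phi> Y)))"

definition semidirect_bracket ::
    "real^2^2 \<Rightarrow> real \<times> (real^2) \<Rightarrow> real \<times> (real^2) \<Rightarrow> real \<times> (real^2)" where
  "semidirect_bracket M = (\<lambda>(s, x) (t, y). (0, s *\<^sub>R (M *v y) - t *\<^sub>R (M *v x)))"

text \<open>All eigenvalues, a priori complex numbers, are real.\<close>

definition has_real_eigenvalues :: "real^'n^'n \<Rightarrow> bool" where
  "has_real_eigenvalues M \<longleftrightarrow>
     (\<forall>z::complex. (\<exists>v::complex^'n. v \<noteq> 0 \<and> map_matrix complex_of_real M *v v = z *s v)
        \<longrightarrow> z \<in> \<real>)"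

section \<open>Metrics and three-forms\<close>

definition pseudo_metric :: "('a::real_vector \<Rightarrow> 'a \<Rightarrow> real) \<Rightarrow> bool" where
  "pseudo_metric g \<longleftrightarrow> bilinear g \<and> (\<forall>X Y. g X Y = g Y X) \<and>
     (\<forall>X. (\<forall>Y. g X Y = 0) \<longrightarrow> X = 0)"

definition degenerate_on :: "('a::real_vector \<Rightarrow> 'a \<Rightarrow> real) \<Rightarrow> 'a set \<Rightarrow> bool" where
  "degenerate_on g S \<longleftrightarrow> (\<exists>X\<in>S. X \<noteq> 0 \<and> (\<forall>Y\<in>S. g X Y = 0))"

definition three_form :: "('a::real_vector \<Rightarrow> 'a \<Rightarrow> 'a \<Rightarrow> real) \<Rightarrow> bool" where
  "three_form H \<longleftrightarrow>
     (\<forall>Y Z. linear (\<lambda>X. H X Y Z)) \<and> (\<forall>X Z. linear (\<lambda>Y. H X Y Z)) \<and>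
     (\<forall>X Y. linear (\<lambda>Z. H X Y Z)) \<and>
     (\<forall>X Y. H X X Y = 0 \<and> H X Y Y = 0 \<and> H X Y X = 0)"

section \<open>The generalized tangent space\<close>

type_synonym 'a gen = "'a \<times> ('a \<Rightarrow>\<^sub>L real)"

definition pairing :: "'a::euclidean_space gen \<Rightarrow> 'a gen \<Rightarrow> real" where
  "pairing = (\<lambda>(X, \<xi>) (Y, \<eta>). (blinfun_apply \<xi> Y + blinfun_apply \<eta> X) / 2)"

definition ad_star ::
    "('a::euclidean_space \<Rightarrow> 'a \<Rightarrow> 'a) \<Rightarrow> 'a \<Rightarrow> ('a \<Rightarrow>\<^sub>L real) \<Rightarrow> ('a \<Rightarrow>\<^sub>L real)" where
  "ad_star br X \<eta> = Blinfun (\<lambda>Y. blinfun_apply \<eta> (br X Y))"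

definition dorfman ::
    "('a::euclidean_space \<Rightarrow> 'a \<Rightarrow> 'a) \<Rightarrow> ('a \<Rightarrow> 'a \<Rightarrow> 'a \<Rightarrow> real) \<Rightarrow> 'a gen \<Rightarrow> 'a gen \<Rightarrow> 'a gen" where
  "dorfman br H = (\<lambda>(X, \<xi>) (Y, \<eta>).
     (br X Y, - ad_star br X \<eta> + ad_star br Y \<xi> + Blinfun (H X Y)))"

text \<open>The eigenbundles of the generalized metric \<open>\<G>\<^sub>g\<close>.  The metric \<open>g\<close> and \<open>\<G>\<^sub>g\<close> determine
  each other, and \<open>\<G>\<^sub>g\<close> enters below only through these two subspaces, so \<open>g\<close> is
  used as the parameter instead of \<open>\<G>\<^sub>g\<close>.\<close>

definition E_plus :: "('a::euclidean_space \<Rightarrow> 'a \<Rightarrow> real) \<Rightarrow> 'a gen set" where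
  "E_plus g = range (\<lambda>X. (X, Blinfun (g X)))"

definition E_minus :: "('a::euclidean_space \<Rightarrow> 'a \<Rightarrow> real) \<Rightarrow> 'a gen set" where
  "E_minus g = range (\<lambda>X. (X, - Blinfun (g X)))"

section \<open>Generalized connections\<close>

definition gen_connection :: "('a::euclidean_space gen \<Rightarrow> 'a gen \<Rightarrow> 'a gen) \<Rightarrow> bool" where
  "gen_connection D \<longleftrightarrow> bilinear D \<and>
     (\<forall>u v w. pairing (D u v) w + pairing v (D u w) = 0)"

definition pairing_adjoint ::
    "('a::euclidean_space gen \<Rightarrow> 'a gen) \<Rightarrow> ('a gen \<Rightarrow> 'a gen)" where
  "pairing_adjoint A = (THE B. \<forall>x y. pairing (A x) y = pairing x (B y))"

definition torsion ::
    "('a::euclidean_space \<Rightarrow> 'a \<Rightarrow> 'a) \<Rightarrow> ('a \<Rightarrow> 'a \<Rightarrow> 'a \<Rightarrow> real) \<Rightarrow>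
     ('a gen \<Rightarrow> 'a gen \<Rightarrow> 'a gen) \<Rightarrow> 'a gen \<Rightarrow> 'a gen \<Rightarrow> 'a gen" where
  "torsion br H D u v =
     D u v - D v u - dorfman br H u v + pairing_adjoint (\<lambda>w. D w u) v"

definition levi_civita ::
    "('a::euclidean_space \<Rightarrow> 'a \<Rightarrow> 'a) \<Rightarrow> ('a \<Rightarrow> 'a \<Rightarrow> 'a \<Rightarrow> real) \<Rightarrow> ('a \<Rightarrow> 'a \<Rightarrow> real) \<Rightarrow>
     ('a gen \<Rightarrow> 'a gen \<Rightarrow> 'a gen) \<Rightarrow> bool" where
  "levi_civita br H g D \<longleftrightarrow> gen_connection D \<and> (\<forall>u v. torsion br H D u v = 0) \<and>
     (\<forall>u. D u ` E_plus g \<subseteq> E_plus g \<and> D u ` E_minus g \<subseteq> E_minus g)"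

definition divergence :: "('a::euclidean_space gen \<Rightarrow> 'a gen \<Rightarrow> 'a gen) \<Rightarrow> 'a gen \<Rightarrow> real" where
  "divergence D v = trace_on UNIV (\<lambda>u. D u v)"

definition gen_curvature ::
    "('a::euclidean_space \<Rightarrow> 'a \<Rightarrow> 'a) \<Rightarrow> ('a \<Rightarrow> 'a \<Rightarrow> 'a \<Rightarrow> real) \<Rightarrow>
     ('a gen \<Rightarrow> 'a gen \<Rightarrow> 'a gen) \<Rightarrow> 'a gen \<Rightarrow> 'a gen \<Rightarrow> 'a gen \<Rightarrow> 'a gen" where
  "gen_curvature br H D u v w = D u (D v w) - D v (D u w) - D (dorfman br H u v) w"

section \<open>Generalized Einstein structures\<close>

text \<open>For every linear form \<open>\<delta>\<close> there is a Levi-Civita generalized connection with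
  divergence \<open>\<delta>\<close>; one is chosen, and the Ricci tensors do not depend on the choice.\<close>

definition lc_with_divergence ::
    "('a::euclidean_space \<Rightarrow> 'a \<Rightarrow> 'a) \<Rightarrow> ('a \<Rightarrow> 'a \<Rightarrow> 'a \<Rightarrow> real) \<Rightarrow> ('a \<Rightarrow> 'a \<Rightarrow> real) \<Rightarrow>
     ('a gen \<Rightarrow> real) \<Rightarrow> 'a gen \<Rightarrow> 'a gen \<Rightarrow> 'a gen" where
  "lc_with_divergence br H g \<delta> = (SOME D. levi_civita br H g D \<and> divergence D = \<delta>)"

definition ricci_plus ::
    "('a::euclidean_space \<Rightarrow> 'a \<Rightarrow> 'a) \<Rightarrow> ('a \<Rightarrow> 'a \<Rightarrow> 'a \<Rightarrow> real) \<Rightarrow> ('a \<Rightarrow> 'a \<Rightarrow> real) \<Rightarrow>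
     ('a gen \<Rightarrow> real) \<Rightarrow> 'a gen \<Rightarrow> 'a gen \<Rightarrow> real" where
  "ricci_plus br H g \<delta> u v =
     trace_on (E_plus g) (\<lambda>w. gen_curvature br H (lc_with_divergence br H g \<delta>) w u v)"

definition ricci_minus ::
    "('a::euclidean_space \<Rightarrow> 'a \<Rightarrow> 'a) \<Rightarrow> ('a \<Rightarrow> 'a \<Rightarrow> 'a \<Rightarrow> real) \<Rightarrow> ('a \<Rightarrow> 'a \<Rightarrow> real) \<Rightarrow>
     ('a gen \<Rightarrow> real) \<Rightarrow> 'a gen \<Rightarrow> 'a gen \<Rightarrow> real" where
  "ricci_minus br H g \<delta> u v =
     trace_on (E_minus g) (\<lambda>w. gen_curvature br H (lc_with_divergence br H g \<delta>) w u v)"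

definition generalized_einstein ::
    "('a::euclidean_space \<Rightarrow> 'a \<Rightarrow> 'a) \<Rightarrow> ('a \<Rightarrow> 'a \<Rightarrow> 'a \<Rightarrow> real) \<Rightarrow> ('a \<Rightarrow> 'a \<Rightarrow> real) \<Rightarrow>
     ('a gen \<Rightarrow> real) \<Rightarrow> bool" where
  "generalized_einstein br H g \<delta> \<longleftrightarrow> three_form H \<and> pseudo_metric g \<and> linear \<delta> \<and>
     (\<forall>u\<in>E_minus g. \<forall>v\<in>E_plus g. ricci_plus br H g \<delta> u v = 0) \<and>
     (\<forall>u\<in>E_plus g. \<forall>v\<in>E_minus g. ricci_minus br H g \<delta> u v = 0)"

end

theory Submission
  imports Defs
begin

text \<open>
  Lifting \<open>X\<close> to \<open>X \<plusminus> g X\<close> identifies both \<open>E\<^sub>\<plusminus>\<close> with the Lie algebra. Vanishing torsion forces the mixed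
  parts of a Levi-Civita generalized connection to be the metric connections
  \<open>\<nabla>\<^sup>\<plusminus> = \<nabla> \<plusminus> (1/2) g\<^sup>-\<^sup>1 H\<close>, and in the trace defining \<open>Ric\<^sup>+\<close> the remaining, non-unique parts survive only
  through the divergence. The Einstein equations become
  \<open>\<delta> ((\<nabla>\<^sup>\<plusminus>\<^sub>X Y)\<^sub>\<plusminus>) = tr (Z \<mapsto> \<nabla>\<^sup>\<plusminus>\<^sub>W Y)\<close> with \<open>W = \<nabla>\<^sup>\<mp>\<^sub>Z X\<close>.

  If \<open>g\<close> is degenerate on the unimodular kernel, there is a frame \<open>l, n, e\<close> with \<open>n, e\<close> in the kernel,
  \<open>l, n\<close> null, \<open>g(l, n) = 1\<close> and \<open>e\<close> a unit vector orthogonal to both. In this frame the equations force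
  \<open>H(l, n, e) = 0\<close> and \<open>[l, n]\<close> to be a multiple of \<open>n\<close>, so that \<open>M\<close> has a real eigenvector. Conversely, a real
  eigenvector for a non-zero eigenvalue (one exists, as the trace is non-zero) serves as \<open>n\<close>, with \<open>H = 0\<close> and
  \<open>\<delta>\<close> a multiple of \<open>g(n, \<cdot>)\<close>.
\<close>

section \<open>Traces\<close>

text \<open>Every trace below is evaluated through this. Forms dual to a spanning family are its
  coordinates on \<open>S\<close>, and comparing them with coordinates in the basis chosen by
  \<open>SOME\<close> is the usual change of basis argument. The forms live on the whole space, so
  that projections of \<open>E\<close> can serve as coordinates on \<open>E_plus\<close>.\<close>

lemma trace_on_eq:
  fixes f :: "'v::real_vector \<Rightarrow> 'v" and e :: "'i \<Rightarrow> 'v"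
  assumes I: "finite I" and f: "linear f" and fS: "f ` S \<subseteq> S" and S: "span (e ` I) = S"
    and \<phi>: "\<And>i. i \<in> I \<Longrightarrow> linear (\<phi> i)"
    and dual: "\<And>i j. i \<in> I \<Longrightarrow> j \<in> I \<Longrightarrow> \<phi> i (e j) = (if i = j then 1 else 0)"
  shows "trace_on S f = (\<Sum>i\<in>I. \<phi> i (f (e i)))"
proof -
  have expand: "x = (\<Sum>i\<in>I. \<phi> i x *\<^sub>R e i)" if "x \<in> S" for x
  proof -
    have "x \<in> span (e ` I)" using that S by simp
    then show ?thesis
    proof (induction rule: span_induct_alt)
      case base
      then show ?case using linear_0[OF \<phi>] by simp
    next
      case (step c x y)
      then obtain j where j: "j \<in> I" "x = e j" by auto
      have "(\<Sum>i\<in>I. \<phi> i (c *\<^sub>R x + y) *\<^sub>R e i)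
          = (\<Sum>i\<in>I. (c * \<phi> i (e j)) *\<^sub>R e i + \<phi> i y *\<^sub>R e i)"
        by (intro sum.cong refl) (simp add: linear_add[OF \<phi>] linear_scale[OF \<phi>] j scaleR_add_left)
      also have "\<dots> = (\<Sum>i\<in>I. (if i = j then c *\<^sub>R e j else 0)) + (\<Sum>i\<in>I. \<phi> i y *\<^sub>R e i)"
        unfolding sum.distrib by (intro arg_cong2[where f = "(+)"] sum.cong refl) (auto simp: dual j)
      also have "\<dots> = c *\<^sub>R x + y" using step.IH I j by simp
      finally show ?case by simp
    qed
  qed
  define B where "B = (SOME B. independent B \<and> span B = S)"
  have "\<exists>B. independent B \<and> span B = S"
    by (metis S basis_exists maximal_independent_subset span_eq span_span span_subspace subspace_span)
  then have B: "independent B" "span B = S" unfolding B_def by (metis (mono_tags, lifting) someI_ex)+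
  have finB: "finite B"
    using independent_span_bound[of "e ` I" B] I B S span_superset by blast
  have "trace_on S f = (\<Sum>b\<in>B. representation B (f b) b)"
    unfolding trace_on_def Let_def B_def by simp
  also have "\<dots> = (\<Sum>b\<in>B. \<Sum>i\<in>I. \<phi> i (f b) * representation B (e i) b)"
  proof (rule sum.cong[OF refl])
    fix b assume "b \<in> B"
    then have fb: "f b \<in> S" using fS span_base[of b B] by (auto simp: B(2))
    have eS: "e i \<in> span B" if "i \<in> I" for i
      unfolding B(2) S[symmetric] by (intro span_base imageI that)
    have "representation B (f b) = representation B (\<Sum>i\<in>I. \<phi> i (f b) *\<^sub>R e i)"
      using expand[OF fb] by simp
    also have "\<dots> = (\<lambda>b'. \<Sum>i\<in>I. representation B (\<phi> i (f b) *\<^sub>R e i) b')"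
      using eS by (intro representation_sum B(1)) (auto intro: span_scale)
    also have "\<dots> = (\<lambda>b'. \<Sum>i\<in>I. \<phi> i (f b) * representation B (e i) b')"
      using eS by (intro ext sum.cong refl) (simp add: representation_scale[OF B(1)])
    finally show "representation B (f b) b = (\<Sum>i\<in>I. \<phi> i (f b) * representation B (e i) b)"
      by simp
  qed
  also have "\<dots> = (\<Sum>i\<in>I. \<Sum>b\<in>B. \<phi> i (f b) * representation B (e i) b)"
    by (rule sum.swap)
  also have "\<dots> = (\<Sum>i\<in>I. \<phi> i (f (e i)))"
  proof (rule sum.cong[OF refl])
    fix i assume i: "i \<in> I"
    have "(\<Sum>b\<in>B. representation B (e i) b *\<^sub>R b) = e i"
      using finB span_base[of "e i" "e ` I"] i by (intro sum_representation_eq B(1)) (auto simp: B(2) S)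
    then have "\<phi> i (f (e i)) = \<phi> i (f (\<Sum>b\<in>B. representation B (e i) b *\<^sub>R b))" by simp
    also have "\<dots> = (\<Sum>b\<in>B. \<phi> i (f b) * representation B (e i) b)"
      by (simp add: linear_sum[OF f] linear_sum[OF \<phi>[OF i]] linear_scale[OF f]
          linear_scale[OF \<phi>[OF i]] mult.commute)
    finally show "(\<Sum>b\<in>B. \<phi> i (f b) * representation B (e i) b) = \<phi> i (f (e i))" by simp
  qed
  finally show ?thesis .
qed

lemma trace_on_UNIV:
  fixes f :: "'a::euclidean_space \<Rightarrow> 'a"
  assumes "linear f"
  shows "trace_on UNIV f = (\<Sum>i\<in>Basis. f i \<bullet> i)"
proof (rule trace_on_eq[where e = "\<lambda>i. i"])
  show "linear (\<lambda>x. x \<bullet> i)" for i :: 'a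
    by (simp add: bounded_linear.linear bounded_linear_inner_left)
qed (use assms in \<open>auto simp: inner_Basis\<close>)

lemma trace_on_UNIV_commute:
  fixes f h :: "'a::euclidean_space \<Rightarrow> 'a"
  assumes f: "linear f" and h: "linear h"
  shows "trace_on UNIV (\<lambda>x. f (h x)) = trace_on UNIV (\<lambda>x. h (f x))"
proof -
  have *: "(\<Sum>i\<in>Basis. f (h i) \<bullet> i) = (\<Sum>i\<in>Basis. \<Sum>j\<in>Basis. (h i \<bullet> j) * (f j \<bullet> i))"
    if f: "linear f" for f h :: "'a \<Rightarrow> 'a"
  proof (rule sum.cong[OF refl])
    fix i :: 'a
    have "f (h i) = f (\<Sum>j\<in>Basis. (h i \<bullet> j) *\<^sub>R j)" by (simp add: euclidean_representation)
    then show "f (h i) \<bullet> i = (\<Sum>j\<in>Basis. (h i \<bullet> j) * (f j \<bullet> i))"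
      by (simp add: linear_sum[OF f] linear_scale[OF f] inner_sum_left)
  qed
  have "linear (\<lambda>x. f (h x))" "linear (\<lambda>x. h (f x))"
    using linear_compose[OF f h] linear_compose[OF h f] by (simp_all add: o_def)
  moreover have "(\<Sum>i\<in>Basis. \<Sum>j\<in>Basis. (h i \<bullet> j) * (f j \<bullet> i))
      = (\<Sum>i\<in>Basis. \<Sum>j\<in>Basis. (f i \<bullet> j) * (h j \<bullet> i))"
    by (subst sum.swap) (simp add: mult.commute)
  ultimately show ?thesis
    using *[OF f, of h] *[OF h, of f] by (simp add: trace_on_UNIV)
qed

lemma trace_on_UNIV_diff:
  fixes f h :: "'a::euclidean_space \<Rightarrow> 'a"
  assumes "linear f" "linear h"
  shows "trace_on UNIV (\<lambda>x. f x - h x) = trace_on UNIV f - trace_on UNIV h"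
  using assms by (simp add: trace_on_UNIV linear_compose_sub inner_diff_left sum_subtractf)

lemma blinfun_apply_Blinfun_linear:
  fixes f :: "'a::euclidean_space \<Rightarrow> real"
  assumes "linear f"
  shows "blinfun_apply (Blinfun f) = f"
  using assms by (intro bounded_linear_Blinfun_apply) (simp add: linear_linear)

section \<open>Pseudo-metrics\<close>

text \<open>The inverse of the map from X to \<open>g X\<close>; the value is meaningful for
  non-degenerate \<open>g\<close> and linear forms.\<close>

definition sharp :: "('a::real_vector \<Rightarrow> 'a \<Rightarrow> real) \<Rightarrow> ('a \<Rightarrow> real) \<Rightarrow> 'a" where
  "sharp g \<phi> = (THE W. \<forall>Z. g W Z = \<phi> Z)"

text \<open>\<open>E_minus g\<close> is the range of \<open>lift (- g)\<close>, so every statement about \<open>E_plus\<close> holds for \<open>E_minus\<close>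
  with \<open>- g\<close> in place of \<open>g\<close>.\<close>

definition lift :: "('a::euclidean_space \<Rightarrow> 'a \<Rightarrow> real) \<Rightarrow> 'a \<Rightarrow> 'a gen" where
  "lift g X = (X, Blinfun (g X))"

text \<open>The coordinate of the \<open>E_plus\<close> component in the splitting of
  \<open>E\<close> into eigenbundles; with \<open>- g\<close> it gives the coordinate of the
  \<open>E_minus\<close> component.\<close>

definition proj :: "('a::euclidean_space \<Rightarrow> 'a \<Rightarrow> real) \<Rightarrow> 'a gen \<Rightarrow> 'a" where
  "proj g u = (1 / 2) *\<^sub>R (fst u + sharp g (blinfun_apply (snd u)))"

lemma uminus_uminus_form: "- (- g) = (g :: 'a \<Rightarrow> 'b \<Rightarrow> real)"
  by (simp add: fun_eq_iff)

locale pmetric =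
  fixes g :: "'a::euclidean_space \<Rightarrow> 'a \<Rightarrow> real"
  assumes pm: "pseudo_metric g"
begin

lemma bilinear_g: "bilinear g" using pm by (simp add: pseudo_metric_def)
lemma sym: "g X Y = g Y X" using pm by (auto simp: pseudo_metric_def)
lemma nondegenerate: "(\<And>Y. g X Y = 0) \<Longrightarrow> X = 0" using pm by (auto simp: pseudo_metric_def)

lemmas add_l = bilinear_ladd[OF bilinear_g] and add_r = bilinear_radd[OF bilinear_g]
  and diff_l = bilinear_lsub[OF bilinear_g] and diff_r = bilinear_rsub[OF bilinear_g]
  and scale_l = bilinear_lmul[OF bilinear_g] and scale_r = bilinear_rmul[OF bilinear_g]
  and neg_l = bilinear_lneg[OF bilinear_g] and neg_r = bilinear_rneg[OF bilinear_g]
  and zero_l = bilinear_lzero[OF bilinear_g] and zero_r = bilinear_rzero[OF bilinear_g]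

lemmas g_simps = add_l add_r diff_l diff_r scale_l scale_r neg_l neg_r zero_l zero_r

lemma eqI: "(\<And>Z. g V Z = g W Z) \<Longrightarrow> V = W"
  using nondegenerate[of "V - W"] by (simp add: diff_l)

lemma linear_r: "linear (g X)" and linear_l: "linear (\<lambda>X. g X Y)"
  using bilinear_g by (simp_all add: bilinear_def)

lemma uminus: "pmetric (- g)"
  using pm unfolding pmetric_def pseudo_metric_def bilinear_def
  by (auto simp: linear_compose_neg linear_iff)

text \<open>The Gram operator \<open>T\<close> of \<open>g\<close> for the auxiliary inner product
  is injective because \<open>g\<close> is non-degenerate, hence surjective in finite
  dimension.\<close>

lemma sharp_ex:
  assumes \<phi>: "linear \<phi>"
  shows "\<exists>W. \<forall>Z. g W Z = \<phi> Z"
proof -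
  define T where "T X = (\<Sum>i\<in>Basis. g X i *\<^sub>R i)" for X
  have T: "T X \<bullet> Z = g X Z" for X Z
  proof -
    have "g X Z = g X (\<Sum>i\<in>Basis. (Z \<bullet> i) *\<^sub>R i)" by (simp add: euclidean_representation)
    then show ?thesis
      by (simp add: T_def linear_sum[OF linear_r] scale_r inner_sum_left inner_sum_right inner_commute mult.commute)
  qed
  have "linear T"
    unfolding T_def by (auto intro!: linearI simp: g_simps scaleR_add_left sum.distrib scaleR_sum_right)
  moreover have "inj T"
    by (rule injI, rule eqI) (metis T)
  ultimately have "surj T" by (rule linear_inj_imp_surj)
  then obtain W where W: "T W = (\<Sum>i\<in>Basis. \<phi> i *\<^sub>R i)" by (metis surjD)
  have "g W Z = \<phi> Z" for Z
  proof -
    have "\<phi> Z = \<phi> (\<Sum>i\<in>Basis. (Z \<bullet> i) *\<^sub>R i)" by (simp add: euclidean_representation)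
    then have "\<phi> Z = (\<Sum>i\<in>Basis. \<phi> i *\<^sub>R i) \<bullet> Z"
      by (simp add: linear_sum[OF \<phi>] linear_scale[OF \<phi>] inner_sum_left inner_sum_right inner_commute mult.commute)
    then show ?thesis using T W by metis
  qed
  then show ?thesis by blast
qed

lemma g_sharp: "linear \<phi> \<Longrightarrow> g (sharp g \<phi>) Z = \<phi> Z"
proof -
  assume "linear \<phi>"
  then have "\<exists>!W. \<forall>Z. g W Z = \<phi> Z" using sharp_ex eqI by metis
  from theI'[OF this] show ?thesis unfolding sharp_def by blast
qed

lemma sharp_g: "sharp g (g X) = X"
  by (rule eqI) (simp add: g_sharp linear_r)

lemma Blinfun_g: "blinfun_apply (Blinfun (g X)) = g X"
  by (simp add: blinfun_apply_Blinfun_linear linear_r)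

lemma lift_uminus: "lift (- g) X = (X, - Blinfun (g X))"
proof -
  interpret m: pmetric "- g" by (rule uminus)
  show ?thesis
    unfolding lift_def
    by (simp del: uminus_apply add: prod_eq_iff)
       (rule blinfun_eqI, use m.Blinfun_g[of X] in \<open>simp add: Blinfun_g blinfun.minus_left\<close>)
qed

lemma E_plus_eq: "E_plus g = range (lift g)"
  by (simp add: E_plus_def lift_def)

lemma E_minus_eq: "E_minus g = range (lift (- g))"
  by (simp add: E_minus_def lift_uminus)

lemma linear_lift: "linear (lift g)"
  by (rule linearI)
    (auto simp: lift_def prod_eq_iff Blinfun_g g_simps blinfun.add_left blinfun.scaleR_left intro!: blinfun_eqI)

lemma fst_lift: "fst (lift g X) = X"
  by (simp add: lift_def)

lemma snd_lift: "blinfun_apply (snd (lift g X)) = g X"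
  by (simp add: lift_def Blinfun_g)

lemma sharp_minus: "linear \<phi> \<Longrightarrow> sharp (- g) \<phi> = - sharp g \<phi>"
proof -
  assume \<phi>: "linear \<phi>"
  interpret m: pmetric "- g" by (rule uminus)
  show ?thesis by (rule m.eqI) (simp add: m.g_sharp[OF \<phi>, simplified] g_sharp[OF \<phi>] g_simps)
qed

lemma linear_blinfun_apply: "linear (blinfun_apply \<xi>)" for \<xi> :: "'a \<Rightarrow>\<^sub>L real"
  by (simp add: blinfun.bounded_linear_right bounded_linear.linear)

lemma proj_lift: "proj g (lift g X) = X"
  by (simp add: proj_def fst_lift snd_lift sharp_g flip: scaleR_2)

lemma sharp_linear: "sharp g (\<lambda>Z. r * \<phi> Z + \<psi> Z) = r *\<^sub>R sharp g \<phi> + sharp g \<psi>"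
  if "linear \<phi>" "linear \<psi>"
proof (rule eqI)
  fix Z
  have "linear (\<lambda>Z. r * \<phi> Z + \<psi> Z)" 
    using that by (intro linear_compose_add) (auto intro: linearI simp: linear_add linear_scale distrib_left)
  then show "g (sharp g (\<lambda>Z. r * \<phi> Z + \<psi> Z)) Z = g (r *\<^sub>R sharp g \<phi> + sharp g \<psi>) Z"
    using that by (simp add: g_simps g_sharp)
qed

lemma linear_proj: "linear (proj g)"
proof -
  have *: "sharp g (blinfun_apply (r *\<^sub>R x + y)) = r *\<^sub>R sharp g (blinfun_apply x) + sharp g (blinfun_apply y)"
    for r and x y :: "'a \<Rightarrow>\<^sub>L real"
    using sharp_linear[OF linear_blinfun_apply linear_blinfun_apply, of r x y]
    by (simp add: blinfun.add_left blinfun.scaleR_left plus_blinfun.rep_eq scaleR_blinfun.rep_eq)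
  show ?thesis
    using *[of 1] *[of _ _ 0] *[of 1 0 0]
    by (auto intro!: linearI simp: proj_def algebra_simps)
qed

lemma proj_uminus: "proj (- g) u = fst u - proj g u"
proof -
  define s where "s = sharp g (blinfun_apply (snd u))"
  have "fst u - (1 / 2) *\<^sub>R (fst u + s) = (1 / 2 + 1 / 2) *\<^sub>R fst u - (1 / 2) *\<^sub>R (fst u + s)" by simp
  also have "\<dots> = (1 / 2) *\<^sub>R (fst u - s)" unfolding scaleR_add_left scaleR_add_right scaleR_diff_right by simp
  finally show ?thesis by (simp add: proj_def sharp_minus[OF linear_blinfun_apply] s_def)
qed

lemma proj_uminus_lift: "proj (- g) (lift g X) = 0"
  by (simp add: proj_uminus proj_lift fst_lift)

lemma proj_lift_uminus: "proj g (lift (- g) X) = 0"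
  using pmetric.proj_uminus_lift[OF uminus] by (simp add: uminus_uminus_form)

lemma lift_proj: "lift g (proj g u) + lift (- g) (proj (- g) u) = u"
proof -
  have "g (sharp g (blinfun_apply (snd u))) Y = blinfun_apply (snd u) Y" for Y
    by (rule g_sharp[OF linear_blinfun_apply])
  then have "g (proj g u) Y - g (fst u - proj g u) Y = blinfun_apply (snd u) Y" for Y
    by (simp add: proj_def g_simps field_simps)
  then show ?thesis
    unfolding lift_uminus proj_uminus
    by (auto simp: prod_eq_iff lift_def Blinfun_g blinfun.diff_left intro!: blinfun_eqI)
qed

lemma pairing_lift: "pairing (lift g X) (lift g Y) = g X Y"
  by (simp add: pairing_def lift_def Blinfun_g sym[of Y X])

lemma pairing_lift_uminus: "pairing (lift g X) (lift (- g) Y) = 0"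
  unfolding lift_uminus by (simp add: pairing_def lift_def Blinfun_g blinfun.minus_left sym[of Y X])

end

section \<open>The pairing, adjoints and traces on the generalized tangent space\<close>

lemma bilinear_pairing: "bilinear pairing"
  unfolding bilinear_def
  by (auto intro!: linearI simp: pairing_def split_beta blinfun.add_left blinfun.add_right
      blinfun.scaleR_left blinfun.scaleR_right field_simps)

lemma pairing_commute: "pairing u v = pairing v u"
  by (simp add: pairing_def split_beta)

lemmas pairing_simps =
  bilinear_ladd[OF bilinear_pairing] bilinear_radd[OF bilinear_pairing]
  bilinear_lsub[OF bilinear_pairing] bilinear_rsub[OF bilinear_pairing]
  bilinear_lneg[OF bilinear_pairing] bilinear_rneg[OF bilinear_pairing]
  bilinear_lzero[OF bilinear_pairing] bilinear_rzero[OF bilinear_pairing]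
  bilinear_lmul[OF bilinear_pairing] bilinear_rmul[OF bilinear_pairing]

lemma bilinear_linear:
  assumes "bilinear f"
  shows "linear (f x)" "linear (\<lambda>x. f x y)"
  using assms by (auto simp: bilinear_def)

context pmetric
begin

text \<open>The eigenbundles are orthogonal, and under the lifts the pairing restricts to
  \<open>g\<close> on \<open>E_plus\<close> and to \<open>- g\<close> on
  \<open>E_minus\<close>.\<close>

lemma pairing_eq: "pairing u v = g (proj g u) (proj g v) - g (proj (- g) u) (proj (- g) v)"
proof -
  interpret m: pmetric "- g" by (rule uminus)
  have "pairing u v = pairing (lift g (proj g u) + lift (- g) (proj (- g) u))
      (lift g (proj g v) + lift (- g) (proj (- g) v))"
    by (simp only: lift_proj)
  then show ?thesis
    by (simp only: pairing_simps pairing_lift m.pairing_lift pairing_lift_uminus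
        pairing_commute[of "lift (- g) _" "lift g _"]) simp
qed

lemma gen_eqI:
  assumes "proj g u = proj g v" "proj (- g) u = proj (- g) v"
  shows "u = v"
  by (metis assms lift_proj)

lemma proj_lift_add:
  "proj g (lift g X + lift (- g) Y) = X" "proj (- g) (lift g X + lift (- g) Y) = Y"
proof -
  interpret m: pmetric "- g" by (rule uminus)
  show "proj g (lift g X + lift (- g) Y) = X"
    by (simp add: linear_add[OF linear_proj] proj_lift proj_lift_uminus)
  show "proj (- g) (lift g X + lift (- g) Y) = Y"
    by (simp add: linear_add[OF m.linear_proj] m.proj_lift proj_uminus_lift)
qed

lemma pairing_eqI:
  fixes u v :: "'a gen"
  assumes "\<And>w. pairing u w = pairing v w"
  shows "u = v"
proof (rule gen_eqI)
  interpret m: pmetric "- g" by (rule uminus)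
  show "proj g u = proj g v"
    by (rule eqI) (use assms[of "lift g _"] in \<open>simp add: pairing_eq proj_lift proj_uminus_lift zero_r\<close>)
  show "proj (- g) u = proj (- g) v"
    by (rule m.eqI)
      (use assms[of "lift (- g) _"] in \<open>simp add: pairing_eq proj_lift_uminus m.proj_lift zero_r\<close>)
qed

text \<open>This justifies the \<open>THE\<close> in the adjoint. The witness \<open>B\<close>
  represents, on each eigenbundle separately, the form sending X to the pairing of \<open>A\<close>
  (lift of X) with \<open>y\<close>; non-degeneracy of the pairing gives uniqueness.\<close>

lemma pairing_adjoint:
  fixes A :: "'a gen \<Rightarrow> 'a gen"
  assumes A: "linear A"
  shows "pairing x (pairing_adjoint A y) = pairing (A x) y"
proof -
  interpret m: pmetric "- g" by (rule uminus)
  define B where "B y = lift g (sharp g (\<lambda>X. pairing (A (lift g X)) y))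
      + lift (- g) (sharp (- g) (\<lambda>X. pairing (A (lift (- g) X)) y))" for y
  have lin: "linear (\<lambda>X. pairing (A (lift g X)) y)" "linear (\<lambda>X. pairing (A (lift (- g) X)) y)" for y
    using linear_compose[OF linear_compose[OF linear_lift A] bilinear_linear(2)[OF bilinear_pairing, of y]]
      linear_compose[OF linear_compose[OF m.linear_lift A] bilinear_linear(2)[OF bilinear_pairing, of y]]
    by (simp_all add: o_def)
  have B: "pairing (A x) y = pairing x (B y)" for x y
  proof -
    have "pairing x (B y) = g (sharp g (\<lambda>X. pairing (A (lift g X)) y)) (proj g x)
        + (- g) (sharp (- g) (\<lambda>X. pairing (A (lift (- g) X)) y)) (proj (- g) x)"
      by (simp add: pairing_eq B_def proj_lift_add sym)
    also have "\<dots> = pairing (A (lift g (proj g x) + lift (- g) (proj (- g) x))) y"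
      by (simp only: g_sharp m.g_sharp lin linear_add[OF A] pairing_simps)
    finally show ?thesis by (simp add: lift_proj)
  qed
  have "\<exists>!B. \<forall>x y. pairing (A x) y = pairing x (B y)"
  proof (rule ex1I[of _ B])
    show "\<forall>x y. pairing (A x) y = pairing x (B y)" using B by blast
    fix B' assume B': "\<forall>x y. pairing (A x) y = pairing x (B' y)"
    show "B' = B"
    proof (rule ext, rule pairing_eqI)
      show "pairing (B' y) w = pairing (B y) w" for y w
        using B[of w y] B' by (simp add: pairing_commute[of _ w])
    qed
  qed
  from theI'[OF this, folded pairing_adjoint_def] show ?thesis by metis
qed

lemma trace_on_E_plus:
  assumes F: "linear F" and FS: "F ` E_plus g \<subseteq> E_plus g"
  shows "trace_on (E_plus g) F = (\<Sum>i\<in>Basis. proj g (F (lift g i)) \<bullet> i)"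
proof (rule trace_on_eq[where e = "lift g" and \<phi> = "\<lambda>i u. proj g u \<bullet> i"])
  show "span (lift g ` Basis) = E_plus g"
    by (simp add: E_plus_eq linear_span_image[OF linear_lift] span_Basis)
  show "linear (\<lambda>u. proj g u \<bullet> i)" for i :: 'a
    using linear_compose[OF linear_proj bounded_linear.linear[OF bounded_linear_inner_left]]
    by (simp add: o_def)
qed (use assms in \<open>auto simp: inner_Basis proj_lift\<close>)

lemma trace_on_gen:
  fixes F :: "'a gen \<Rightarrow> 'a gen"
  assumes F: "linear F"
  shows "trace_on UNIV F = (\<Sum>i\<in>Basis. proj g (F (lift g i)) \<bullet> i)
    + (\<Sum>i\<in>Basis. proj (- g) (F (lift (- g) i)) \<bullet> i)"
proof -
  interpret m: pmetric "- g" by (rule uminus)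
  let ?e = "case_sum (lift g) (lift (- g))"
  let ?\<phi> = "case_sum (\<lambda>i u. proj g u \<bullet> i) (\<lambda>i u. proj (- g) u \<bullet> i)"
  have "trace_on UNIV F = (\<Sum>i\<in>Basis <+> Basis. ?\<phi> i (F (?e i)))"
  proof (rule trace_on_eq)
    have "u \<in> span (?e ` (Basis <+> Basis))" for u :: "'a gen"
    proof -
      have *: "?e ` (Basis <+> Basis) = lift g ` Basis \<union> lift (- g) ` Basis"
        by (simp add: Plus_def image_Un image_image)
      have "lift g X \<in> span (lift g ` Basis \<union> lift (- g) ` Basis)"
        "lift (- g) X \<in> span (lift g ` Basis \<union> lift (- g) ` Basis)" for X
        unfolding span_Un linear_span_image[OF linear_lift] linear_span_image[OF m.linear_lift] span_Basis
        by (metis (mono_tags, lifting) UNIV_I add.left_neutral add.right_neutral image_eqI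
            linear_0[OF linear_lift] linear_0[OF m.linear_lift] mem_Collect_eq)+
      then show ?thesis unfolding * by (metis lift_proj span_add)
    qed
    then show "span (?e ` (Basis <+> Basis)) = UNIV" by auto
    show "linear (?\<phi> i)" for i
      using linear_compose[OF linear_proj bounded_linear.linear[OF bounded_linear_inner_left]]
        linear_compose[OF m.linear_proj bounded_linear.linear[OF bounded_linear_inner_left]]
      by (simp add: o_def split: sum.splits)
  qed (use assms in \<open>auto simp: inner_Basis proj_lift m.proj_lift proj_lift_uminus proj_uminus_lift split: if_splits\<close>)
  then show ?thesis by (simp add: sum.Plus)
qed

end

section \<open>Metric connections with skew torsion, and the Dorfman bracket\<close>

definition nabla ::
    "('a::euclidean_space \<Rightarrow> 'a \<Rightarrow> 'a) \<Rightarrow> ('a \<Rightarrow> 'a \<Rightarrow> real) \<Rightarrow> ('a \<Rightarrow> 'a \<Rightarrow> 'a \<Rightarrow> real) \<Rightarrow> 'a \<Rightarrow> 'a \<Rightarrow> 'a" where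
  "nabla br g H X Y =
     sharp g (\<lambda>Z. (g (br X Y) Z - g (br X Z) Y - g (br Y Z) X + H X Y Z) / 2)"

text \<open>The right-hand side is totally skew in X, Y, Z, so the three connection terms of the
  torsion contribute equally; this is why a third of the bracket is taken, which turns the factor
  1/2 of the pairing into 1/6.\<close>

definition balanced ::
    "('a::euclidean_space \<Rightarrow> 'a \<Rightarrow> 'a) \<Rightarrow> ('a \<Rightarrow> 'a \<Rightarrow> real) \<Rightarrow> ('a \<Rightarrow> 'a \<Rightarrow> 'a \<Rightarrow> real) \<Rightarrow> 'a \<Rightarrow> 'a \<Rightarrow> 'a" where
  "balanced br g H X Y =
     sharp g (\<lambda>Z. (g (br X Y) Z - g (br X Z) Y + g (br Y Z) X + H X Y Z) / 6)"

locale metric_algebra = pmetric g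
  for br :: "'a::euclidean_space \<Rightarrow> 'a \<Rightarrow> 'a" and g :: "'a \<Rightarrow> 'a \<Rightarrow> real"
    and H :: "'a \<Rightarrow> 'a \<Rightarrow> 'a \<Rightarrow> real" +
  assumes bilinear_br: "bilinear br" and br_self: "br X X = 0" and form: "three_form H"
begin

lemma linear_br: "linear (br X)" "linear (\<lambda>X. br X Y)"
  using bilinear_br by (simp_all add: bilinear_def)

lemmas br_add_l = bilinear_ladd[OF bilinear_br] and br_add_r = bilinear_radd[OF bilinear_br]
  and br_scale_l = bilinear_lmul[OF bilinear_br] and br_scale_r = bilinear_rmul[OF bilinear_br]
  and br_neg_l = bilinear_lneg[OF bilinear_br] and br_neg_r = bilinear_rneg[OF bilinear_br]
  and br_diff_l = bilinear_lsub[OF bilinear_br] and br_diff_r = bilinear_rsub[OF bilinear_br]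

lemmas br_simps = br_add_l br_add_r br_scale_l br_scale_r br_neg_l br_neg_r br_diff_l br_diff_r

lemma br_skew: "br Y X = - br X Y"
proof -
  have "br X X + br X Y + (br Y X + br Y Y) = 0"
    using br_self[of "X + Y"] unfolding br_simps by (simp add: algebra_simps)
  then show ?thesis by (simp add: br_self eq_neg_iff_add_eq_0 add.commute)
qed

lemma H_linear: "linear (\<lambda>X. H X Y Z)" "linear (\<lambda>Y. H X Y Z)" "linear (\<lambda>Z. H X Y Z)"
  using form by (auto simp: three_form_def)

lemmas H_simps = linear_add[OF H_linear(1)] linear_add[OF H_linear(2)] linear_add[OF H_linear(3)]
  linear_scale[OF H_linear(1)] linear_scale[OF H_linear(2)] linear_scale[OF H_linear(3)]
  linear_neg[OF H_linear(1)] linear_neg[OF H_linear(2)] linear_neg[OF H_linear(3)]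
  linear_diff[OF H_linear(1)] linear_diff[OF H_linear(2)] linear_diff[OF H_linear(3)]

lemma H_skew: "H Y X Z = - H X Y Z" "H X Z Y = - H X Y Z"
proof -
  have *: "H X X Y = 0" "H X Y Y = 0" for X Y using form by (auto simp: three_form_def)
  show "H Y X Z = - H X Y Z" using *(1)[of "X + Y" Z] *(1)[of X Z] *(1)[of Y Z] unfolding H_simps by linarith
  show "H X Z Y = - H X Y Z" using *(2)[of X "Y + Z"] *(2)[of X Y] *(2)[of X Z] unfolding H_simps by linarith
qed

lemma metric_algebra_uminus: "metric_algebra br (- g) H"
  using uminus bilinear_br br_self form
  by (simp add: metric_algebra_def metric_algebra_axioms_def)

lemma linear_rhs:
  "linear (\<lambda>Z. (g (br X Y) Z - g (br X Z) Y - g (br Y Z) X + H X Y Z) / 2)"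
  "linear (\<lambda>Z. (g (br X Y) Z - g (br X Z) Y + g (br Y Z) X + H X Y Z) / 6)"
  by (auto intro!: linearI simp: g_simps br_simps H_simps add_divide_distrib diff_divide_distrib algebra_simps)

text \<open>Koszul's formula for left-invariant fields with H added: \<open>nabla\<close> is the
  metric connection with torsion g^{-1} H.\<close>

lemma nabla: "2 * g (nabla br g H X Y) Z = g (br X Y) Z - g (br X Z) Y - g (br Y Z) X + H X Y Z"
  by (simp add: nabla_def g_sharp linear_rhs)

lemma balanced: "6 * g (balanced br g H X Y) Z = g (br X Y) Z - g (br X Z) Y + g (br Y Z) X + H X Y Z"
  by (simp add: balanced_def g_sharp linear_rhs)

lemma nablaI:
  assumes "\<And>Z. 2 * g W Z = g (br X Y) Z - g (br X Z) Y - g (br Y Z) X + H X Y Z"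
  shows "nabla br g H X Y = W"
proof (rule eqI)
  show "g (nabla br g H X Y) Z = g W Z" for Z using assms[of Z] nabla[of X Y Z] by linarith
qed

lemma bilinear_nabla: "bilinear (nabla br g H)"
  unfolding bilinear_def
proof (intro conjI allI; rule linearI)
  show "nabla br g H X (Y + Y') = nabla br g H X Y + nabla br g H X Y'" for X Y Y'
    by (rule nablaI) (simp add: g_simps br_simps H_simps distrib_left nabla)
  show "nabla br g H (X + X') Y = nabla br g H X Y + nabla br g H X' Y" for X X' Y
    by (rule nablaI) (simp add: g_simps br_simps H_simps distrib_left nabla)
  show "nabla br g H X (r *\<^sub>R Y) = r *\<^sub>R nabla br g H X Y" for r X Y
    by (rule nablaI)
      (simp add: g_simps br_simps H_simps mult.left_commute[of 2] nabla distrib_left right_diff_distrib)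
  show "nabla br g H (r *\<^sub>R X) Y = r *\<^sub>R nabla br g H X Y" for r X Y
    by (rule nablaI)
      (simp add: g_simps br_simps H_simps mult.left_commute[of 2] nabla distrib_left right_diff_distrib)
qed

lemma balancedI:
  assumes "\<And>Z. 6 * g W Z = g (br X Y) Z - g (br X Z) Y + g (br Y Z) X + H X Y Z"
  shows "balanced br g H X Y = W"
proof (rule eqI)
  show "g (balanced br g H X Y) Z = g W Z" for Z using assms[of Z] balanced[of X Y Z] by linarith
qed

lemma bilinear_balanced: "bilinear (balanced br g H)"
  unfolding bilinear_def
proof (intro conjI allI; rule linearI)
  show "balanced br g H X (Y + Y') = balanced br g H X Y + balanced br g H X Y'" for X Y Y'
    by (rule balancedI) (simp add: g_simps br_simps H_simps distrib_left balanced)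
  show "balanced br g H (X + X') Y = balanced br g H X Y + balanced br g H X' Y" for X X' Y
    by (rule balancedI) (simp add: g_simps br_simps H_simps distrib_left balanced)
  show "balanced br g H X (r *\<^sub>R Y) = r *\<^sub>R balanced br g H X Y" for r X Y
    by (rule balancedI)
      (simp add: g_simps br_simps H_simps mult.left_commute[of 6] balanced distrib_left right_diff_distrib)
  show "balanced br g H (r *\<^sub>R X) Y = r *\<^sub>R balanced br g H X Y" for r X Y
    by (rule balancedI)
      (simp add: g_simps br_simps H_simps mult.left_commute[of 6] balanced distrib_left right_diff_distrib)
qed

lemma three_form_uminus: "three_form (- H)"
  using form unfolding three_form_def by (auto simp: linear_iff)

text \<open>All terms of the Koszul formula except H carry \<open>g\<close>, so changing the sign of
  \<open>g\<close> amounts to changing the sign of H. Hence the connection belonging to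
  \<open>E_minus\<close> is the one for \<open>- H\<close>.\<close>

lemma nabla_uminus: "nabla br (- g) H = nabla br g (- H)"
proof (intro ext)
  fix X Y
  interpret m: metric_algebra br "- g" H by (rule metric_algebra_uminus)
  interpret h: metric_algebra br g "- H"
    using three_form_uminus by unfold_locales (auto simp: bilinear_br br_self)
  show "nabla br (- g) H X Y = nabla br g (- H) X Y"
  proof (rule h.nablaI[symmetric])
    show "2 * g (nabla br (- g) H X Y) Z = g (br X Y) Z - g (br X Z) Y - g (br Y Z) X + (- H) X Y Z" for Z
      using m.nabla[of X Y Z] by simp
  qed
qed

lemma pairing_dorfman:
  "pairing (dorfman br H u v) w = (blinfun_apply (snd w) (br (fst u) (fst v))
     - blinfun_apply (snd v) (br (fst u) (fst w)) + blinfun_apply (snd u) (br (fst v) (fst w))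
     + H (fst u) (fst v) (fst w)) / 2"
proof -
  have "linear (\<lambda>Y. blinfun_apply \<xi> (br X Y))" for X and \<xi> :: "'a \<Rightarrow>\<^sub>L real"
    using linear_compose[OF linear_br(1) linear_blinfun_apply] by (simp only: o_def)
  then show ?thesis
    by (simp add: pairing_def dorfman_def split_beta ad_star_def blinfun_apply_Blinfun_linear H_linear
        blinfun.add_left blinfun.diff_left blinfun.minus_left)
qed

lemma bilinear_dorfman: "bilinear (dorfman br H)"
  unfolding bilinear_def
  by (intro conjI allI; rule linearI; rule pairing_eqI)
    (auto simp: pairing_dorfman pairing_simps blinfun.add_left blinfun.add_right blinfun.scaleR_left
      blinfun.scaleR_right br_simps H_simps field_simps)

text \<open>The mixed bracket contains both connections: pairing it with a general element
  \<open>w\<close>, split into its two components, yields the two Koszul formulas.\<close>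

lemma dorfman_lift:
  "dorfman br H (lift (- g) X) (lift g Y) = lift g (nabla br g H X Y) - lift (- g) (nabla br (- g) H Y X)"
proof (rule pairing_eqI)
  fix w
  interpret m: metric_algebra br "- g" H by (rule metric_algebra_uminus)
  have w: "w = lift g (proj g w) + lift (- g) (proj (- g) w)" by (simp add: lift_proj)
  obtain U V where w: "w = lift g U + lift (- g) V" using w by blast
  have 1: "fst w = U + V" "blinfun_apply (snd w) Z = g U Z - g V Z" for Z
    using w unfolding lift_uminus by (simp_all add: lift_def blinfun.add_left blinfun.diff_left blinfun.minus_left Blinfun_g)
  show "pairing (dorfman br H (lift (- g) X) (lift g Y)) w =
      pairing (lift g (nabla br g H X Y) - lift (- g) (nabla br (- g) H Y X)) w"
    using nabla[of X Y U] m.nabla[of Y X V]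
    unfolding pairing_dorfman 1 fst_lift m.fst_lift snd_lift m.snd_lift w pairing_simps
      pairing_lift m.pairing_lift pairing_lift_uminus pairing_commute[of "lift (- g) _" "lift g _"]
    by (simp add: br_simps g_simps H_simps br_skew[of Y X] H_skew[of Y X] sym[of "br _ _"] field_simps)
qed

end

section \<open>Levi-Civita generalized connections and the Ricci tensor\<close>

context metric_algebra
begin

text \<open>Paired with \<open>w\<close>, the torsion loses its abstract adjoint, so its vanishing
  can be tested on components in the eigenbundles.\<close>

lemma pairing_torsion:
  assumes "bilinear D"
  shows "pairing (torsion br H D u v) w =
    pairing (D u v) w - pairing (D v u) w - pairing (dorfman br H u v) w + pairing (D w u) v"
  using pairing_adjoint[OF bilinear_linear(2)[OF assms], of w u v]
  by (simp add: torsion_def pairing_simps pairing_commute[of w])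

lemma levi_civita_range:
  assumes "levi_civita br H g D"
  shows "D u (lift g X) \<in> range (lift g)" "D u (lift (- g) X) \<in> range (lift (- g))"
  using assms unfolding levi_civita_def E_plus_eq E_minus_eq by blast+

text \<open>The torsion is tested on one element of \<open>E_minus\<close> and two of
  \<open>E_plus\<close>. The other two connection terms stay in \<open>E_minus\<close> and pair to
  zero with \<open>E_plus\<close>, which leaves only the mixed term and the bracket.\<close>

lemma levi_civita_mixed:
  assumes D: "levi_civita br H g D"
  shows "D (lift (- g) X) (lift g Y) = lift g (nabla br g H X Y)"
proof -
  interpret m: metric_algebra br "- g" H by (rule metric_algebra_uminus)
  have bil: "bilinear D" and T: "torsion br H D u v = 0" for u v
    using D unfolding levi_civita_def gen_connection_def by blast+
  note pres = levi_civita_range[OF D]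
  obtain W where W: "D (lift (- g) X) (lift g Y) = lift g W" using pres by blast
  have "g W Z = g (nabla br g H X Y) Z" for Z
  proof -
    obtain A B where "D (lift g Y) (lift (- g) X) = lift (- g) A" "D (lift g Z) (lift (- g) X) = lift (- g) B"
      using pres by blast
    moreover have "pairing (torsion br H D (lift (- g) X) (lift g Y)) (lift g Z) = 0"
      by (simp add: T pairing_simps)
    ultimately show ?thesis
      unfolding pairing_torsion[OF bil] dorfman_lift W pairing_simps
      by (simp add: pairing_lift pairing_lift_uminus pairing_commute[of "lift (- g) _" "lift g _"])
  qed
  then show ?thesis using W eqI by metis
qed

text \<open>Passing to \<open>- g\<close> merely exchanges the two eigenbundles, which enter the
  definition symmetrically.\<close>

lemma levi_civita_uminus: "levi_civita br H (- g) D \<longleftrightarrow> levi_civita br H g D"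
proof -
  interpret m: metric_algebra br "- g" H by (rule metric_algebra_uminus)
  show ?thesis
    unfolding levi_civita_def E_plus_eq E_minus_eq m.E_plus_eq m.E_minus_eq uminus_uminus_form
    by blast
qed

text \<open>The undetermined part of D on \<open>E_plus\<close> is \<open>C\<close>. Two of its
  three occurrences, Z to \<open>nabla\<close> of \<open>C Z Y\<close> and Z to
  \<open>C (nabla Z) Y\<close>, cancel by cyclicity of the trace. The third is a divergence, because
  D in \<open>E_minus\<close> directions maps \<open>E_plus\<close> to itself and so adds nothing to
  that trace.\<close>

lemma trace_curvature:
  assumes D: "levi_civita br H g D"
  shows "trace_on (E_plus g) (\<lambda>w. gen_curvature br H D w (lift (- g) X) (lift g Y))
    = divergence D (lift g (nabla br g H X Y))
      - trace_on UNIV (\<lambda>Z. nabla br g H (nabla br (- g) H Z X) Y)"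
proof -
  interpret m: metric_algebra br "- g" H by (rule metric_algebra_uminus)
  have bil: "bilinear D" using D by (auto simp: levi_civita_def gen_connection_def)
  note linD = bilinear_linear[OF bil]
  note linN = bilinear_linear[OF bilinear_nabla]
  note linN' = bilinear_linear[OF m.bilinear_nabla]
  define C where "C Z Y = proj g (D (lift g Z) (lift g Y))" for Z Y
  have C: "D (lift g Z) (lift g Y) = lift g (C Z Y)" for Z Y
    using levi_civita_range(1)[OF D, of "lift g Z" Y] by (auto simp: C_def proj_lift)
  have lC: "linear (\<lambda>Z. C Z Y)" for Y
    unfolding C_def
    using linear_compose[OF linear_compose[OF linear_lift linD(2)] linear_proj] by (simp add: o_def)
  have "linear (\<lambda>w. D w (D u v) - D u (D w v) - D (dorfman br H w u) v)" for u v
    using linD(2)[of "D u v"] linear_compose[OF linD(2)[of v] linD(1)[of u]]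
      linear_compose[OF bilinear_linear(2)[OF bilinear_dorfman, of u] linD(2)[of v]]
    by (intro linear_compose_sub) (simp_all add: o_def)
  then have lin: "linear (\<lambda>w. gen_curvature br H D w u v)" for u v
    by (simp add: gen_curvature_def)
  have curv: "gen_curvature br H D (lift g Z) (lift (- g) X) (lift g Y) =
      lift g (C Z (nabla br g H X Y) - nabla br g H X (C Z Y)
        - nabla br g H (nabla br (- g) H Z X) Y + C (nabla br g H X Z) Y)" for Z
  proof -
    have "dorfman br H (lift g Z) (lift (- g) X)
        = lift (- g) (nabla br (- g) H Z X) - lift g (nabla br g H X Z)"
      using m.dorfman_lift[of Z X] by (simp add: uminus_uminus_form)
    then show ?thesis
      unfolding gen_curvature_def
      by (simp add: levi_civita_mixed[OF D] C bilinear_lsub[OF bil]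
          linear_add[OF linear_lift] linear_diff[OF linear_lift])
  qed
  have maps: "(\<lambda>w. gen_curvature br H D w (lift (- g) X) (lift g Y)) ` E_plus g \<subseteq> E_plus g"
    by (auto simp: E_plus_eq curv)
  have "trace_on (E_plus g) (\<lambda>w. gen_curvature br H D w (lift (- g) X) (lift g Y)) =
      trace_on UNIV (\<lambda>Z. C Z (nabla br g H X Y)) - trace_on UNIV (\<lambda>Z. nabla br g H X (C Z Y))
        - trace_on UNIV (\<lambda>Z. nabla br g H (nabla br (- g) H Z X) Y)
        + trace_on UNIV (\<lambda>Z. C (nabla br g H X Z) Y)"
    using linear_compose[OF lC linN(1)] linear_compose[OF linN'(2) linN(2)] linear_compose[OF linN(1) lC]
    by (simp add: trace_on_E_plus[OF lin maps] curv proj_lift trace_on_UNIV lC o_def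
        inner_diff_left inner_add_left sum.distrib sum_subtractf)
  also have "trace_on UNIV (\<lambda>Z. C (nabla br g H X Z) Y) = trace_on UNIV (\<lambda>Z. nabla br g H X (C Z Y))"
    by (rule trace_on_UNIV_commute[OF lC linN(1)])
  also have "trace_on UNIV (\<lambda>Z. C Z W) = divergence D (lift g W)" for W
  proof -
    have "proj (- g) (D (lift (- g) i) (lift g W)) = 0" for i
      by (simp add: levi_civita_mixed[OF D] proj_uminus_lift)
    then show ?thesis
      by (simp add: divergence_def trace_on_gen[OF linD(2)] C proj_lift trace_on_UNIV[OF lC])
  qed
  finally show ?thesis by linarith
qed

text \<open>The component in \<open>E_plus\<close> of a Levi-Civita connection: \<open>nabla\<close> is forced by the torsion, \<open>balanced\<close> is a
  third of the \<open>E_plus\<close> part of the Dorfman bracket, and the terms in \<open>a\<close> have zero cyclic sum, so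
  that they change the divergence but not the torsion.\<close>

definition half_connection :: "'a \<Rightarrow> 'a gen \<Rightarrow> 'a gen \<Rightarrow> 'a" where
  "half_connection a u v = nabla br g H (proj (- g) u) (proj g v)
     + (balanced br g H (proj g u) (proj g v)
        + (g (proj g u) (proj g v) *\<^sub>R a - g a (proj g v) *\<^sub>R proj g u))"

lemma bilinear_half_connection: "bilinear (half_connection a)"
proof -
  interpret m: pmetric "- g" by (rule uminus)
  show ?thesis
    unfolding bilinear_def half_connection_def
    by (intro conjI allI; rule linearI) (simp_all add: linear_add[OF linear_proj] linear_add[OF m.linear_proj]
      linear_scale[OF linear_proj] linear_scale[OF m.linear_proj]
      bilinear_ladd[OF bilinear_nabla] bilinear_radd[OF bilinear_nabla]
      bilinear_lmul[OF bilinear_nabla] bilinear_rmul[OF bilinear_nabla]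
      bilinear_ladd[OF bilinear_balanced] bilinear_radd[OF bilinear_balanced]
      bilinear_lmul[OF bilinear_balanced] bilinear_rmul[OF bilinear_balanced]
      add_l add_r scale_l scale_r scaleR_add_left scaleR_add_right scaleR_diff_right ac_simps)
qed

text \<open>Metric compatibility holds summand by summand: \<open>nabla\<close>,
  \<open>balanced\<close> and the terms in \<open>a\<close> are each skew in the last two
  slots.\<close>

lemma half_connection_skew:
  "g (half_connection a u v) (proj g w) + g (proj g v) (half_connection a u w) = 0"
proof -
  let ?U = "proj (- g) u" and ?u = "proj g u" and ?v = "proj g v" and ?w = "proj g w"
  have "2 * g (nabla br g H ?U ?v) ?w + 2 * g (nabla br g H ?U ?w) ?v = 0"
    unfolding nabla br_skew[of ?w ?v] H_skew(2)[of ?U ?w ?v] by (simp add: g_simps)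
  moreover have "6 * g (balanced br g H ?u ?v) ?w + 6 * g (balanced br g H ?u ?w) ?v = 0"
    unfolding balanced br_skew[of ?w ?v] H_skew(2)[of ?u ?w ?v] by (simp add: g_simps)
  ultimately show ?thesis
    unfolding sym[of ?v "half_connection a u w"]
    unfolding half_connection_def g_simps by (simp add: algebra_simps)
qed

lemma linear_trace_balanced:
  "linear (\<lambda>W. trace_on UNIV (\<lambda>X. balanced br g H X W))"
  unfolding trace_on_UNIV[OF bilinear_linear(2)[OF bilinear_balanced]]
  by (rule linearI) (simp_all add:
      bilinear_radd[OF bilinear_balanced] bilinear_rmul[OF bilinear_balanced]
      inner_add_left sum.distrib sum_distrib_left)

text \<open>The map sending u to g(u, W) a - g(a, W) u has trace (1 - dim) g(a, W). This vector
  makes up the difference between the trace of \<open>balanced\<close> and \<delta>, which is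
  possible when the dimension is not 1.\<close>

definition divergence_vector :: "('a gen \<Rightarrow> real) \<Rightarrow> 'a" where
  "divergence_vector \<delta> = sharp g (\<lambda>W. (\<delta> (lift g W) - trace_on UNIV (\<lambda>X. balanced br g H X W)) / (1 - real DIM('a)))"

lemma trace_half_connection:
  assumes \<delta>: "linear \<delta>" and dim: "DIM('a) \<noteq> 1"
  shows "(\<Sum>i\<in>Basis. half_connection (divergence_vector \<delta>) (lift g i) v \<bullet> i) = \<delta> (lift g (proj g v))"
proof -
  let ?a = "divergence_vector \<delta>" and ?V = "proj g v"
  have lin: "linear (\<lambda>W. (\<delta> (lift g W) - trace_on UNIV (\<lambda>X. balanced br g H X W)) / (1 - real DIM('a)))"
    using linear_compose_sub[OF linear_compose[OF linear_lift \<delta>] linear_trace_balanced]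
    by (auto simp: linear_iff o_def add_divide_distrib)
  have a: "g ?a W * (1 - real DIM('a)) = \<delta> (lift g W) - trace_on UNIV (\<lambda>X. balanced br g H X W)" for W
    unfolding divergence_vector_def g_sharp[OF lin] using dim by simp
  have "half_connection ?a (lift g i) v = balanced br g H i ?V + (g i ?V *\<^sub>R ?a - g ?a ?V *\<^sub>R i)" for i
    by (simp add: half_connection_def proj_lift proj_uminus_lift bilinear_lzero[OF bilinear_nabla])
  then have "(\<Sum>i\<in>Basis. half_connection ?a (lift g i) v \<bullet> i) =
      trace_on UNIV (\<lambda>X. balanced br g H X ?V) + (\<Sum>i\<in>Basis. g i ?V * (?a \<bullet> i)) - g ?a ?V * DIM('a)"
    by (simp add: trace_on_UNIV bilinear_linear(2)[OF bilinear_balanced] inner_add_left inner_diff_left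
        sum.distrib sum_subtractf mult.commute)
  also have "(\<Sum>i\<in>Basis. g i ?V * (?a \<bullet> i)) = g (\<Sum>i\<in>Basis. (?a \<bullet> i) *\<^sub>R i) ?V"
    unfolding linear_sum[OF linear_l] by (simp add: scale_l mult.commute)
  also have "\<dots> = g ?a ?V" by (simp add: euclidean_representation)
  finally show ?thesis using a[of ?V] by (simp add: algebra_simps)
qed

text \<open>Each eigenbundle carries its own half connection; the vectors \<open>a\<close> and
  \<open>b\<close> adjust the divergence on \<open>E_plus\<close> and \<open>E_minus\<close>
  independently.\<close>

lemma ex_levi_civita:
  assumes \<delta>: "linear \<delta>" and dim: "DIM('a) \<noteq> 1"
  shows "\<exists>D. levi_civita br H g D \<and> divergence D = \<delta>"
proof -
  interpret m: metric_algebra br "- g" H by (rule metric_algebra_uminus)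
  define a where "a = divergence_vector \<delta>"
  define b where "b = m.divergence_vector \<delta>"
  define D where "D u v = lift g (half_connection a u v) + lift (- g) (m.half_connection b u v)" for u v
  have proj_D: "proj g (D u v) = half_connection a u v" "proj (- g) (D u v) = m.half_connection b u v"
    for u v
    by (simp_all add: D_def proj_lift_add)
  have bil: "bilinear D"
    unfolding bilinear_def
    by (intro conjI allI; rule linearI)
      (simp_all add: D_def linear_add[OF linear_lift] linear_add[OF m.linear_lift]
        linear_scale[OF linear_lift] linear_scale[OF m.linear_lift]
        bilinear_ladd[OF bilinear_half_connection] bilinear_radd[OF bilinear_half_connection]
        bilinear_lmul[OF bilinear_half_connection] bilinear_rmul[OF bilinear_half_connection]
        bilinear_ladd[OF m.bilinear_half_connection] bilinear_radd[OF m.bilinear_half_connection]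
        bilinear_lmul[OF m.bilinear_half_connection] bilinear_rmul[OF m.bilinear_half_connection]
        scaleR_add_right)
  have skew: "pairing (D u v) w + pairing v (D u w) = 0" for u v w
    using half_connection_skew[of a u v w] m.half_connection_skew[of b u v w]
    by (simp add: pairing_eq proj_D)
  have torsion: "torsion br H D u v = 0" for u v
  proof (rule pairing_eqI)
    fix w
    obtain U U' V V' W W' where UVW:
      "u = lift g U + lift (- g) U'" "v = lift g V + lift (- g) V'" "w = lift g W + lift (- g) W'"
      by (metis lift_proj)
    have fst: "fst (lift g A + lift (- g) B) = A + B"
      and snd: "blinfun_apply (snd (lift g A + lift (- g) B)) Z = g A Z - g B Z" for A B Z
      unfolding lift_uminus
      by (simp_all add: lift_def blinfun.add_left blinfun.diff_left blinfun.minus_left Blinfun_g)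
    note skews = br_skew[of U V] br_skew[of U V'] br_skew[of U' V] br_skew[of U' V']
      br_skew[of U W] br_skew[of U W'] br_skew[of U' W] br_skew[of U' W']
      br_skew[of V W] br_skew[of V W'] br_skew[of V' W] br_skew[of V' W']
    note H_skews = H_skew(1)[of U V] H_skew(1)[of U V'] H_skew(1)[of U' V] H_skew(1)[of U' V']
      H_skew(1)[of U W] H_skew(1)[of U W'] H_skew(1)[of U' W] H_skew(1)[of U' W']
      H_skew(1)[of V W] H_skew(1)[of V W'] H_skew(1)[of V' W] H_skew(1)[of V' W']
      H_skew(2)[of _ U V] H_skew(2)[of _ U V'] H_skew(2)[of _ U' V] H_skew(2)[of _ U' V']
      H_skew(2)[of _ U W] H_skew(2)[of _ U W'] H_skew(2)[of _ U' W] H_skew(2)[of _ U' W']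
      H_skew(2)[of _ V W] H_skew(2)[of _ V W'] H_skew(2)[of _ V' W] H_skew(2)[of _ V' W']
    \<comment> \<open>The factor 6 clears the denominators. Total skewness merges the three
      \<open>balanced\<close> terms into one with factor 3, and the terms in \<open>a\<close> cancel
      since their cyclic sum is zero.\<close>
    have plus: "6 * (g (half_connection a u v) W - g (half_connection a v u) W + g (half_connection a w u) V)
      = 3 * (g (br U' V) W - g (br U' W) V - g (br V W) U' + H U' V W)
      - 3 * (g (br V' U) W - g (br V' W) U - g (br U W) V' + H V' U W)
      + 3 * (g (br W' U) V - g (br W' V) U - g (br U V) W' + H W' U V)
      + 3 * (g (br U V) W - g (br U W) V + g (br V W) U + H U V W)"
      using nabla[of U' V W] nabla[of V' U W] nabla[of W' U V]
        balanced[of U V W] balanced[of V U W] balanced[of W U V]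
      unfolding half_connection_def UVW proj_lift_add skews H_skews
      by (simp add: g_simps sym[of V U] sym[of W U] sym[of W V])
    \<comment> \<open>The same on \<open>E_minus\<close>; rewriting the formulas for
      \<open>- g\<close> in terms of \<open>g\<close> reverses the sign of H.\<close>
    have minus: "6 * (g (m.half_connection b u v) W' - g (m.half_connection b v u) W' + g (m.half_connection b w u) V')
      = 3 * (g (br U V') W' - g (br U W') V' - g (br V' W') U - H U V' W')
      - 3 * (g (br V U') W' - g (br V W') U' - g (br U' W') V - H V U' W')
      + 3 * (g (br W U') V' - g (br W V') U' - g (br U' V') W - H W U' V')
      + 3 * (g (br U' V') W' - g (br U' W') V' + g (br V' W') U' - H U' V' W')"
      using m.nabla[of U V' W'] m.nabla[of V U' W'] m.nabla[of W U' V']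
        m.balanced[of U' V' W'] m.balanced[of V' U' W'] m.balanced[of W' U' V']
      unfolding m.half_connection_def UVW uminus_uminus_form proj_lift_add skews H_skews
      by (simp add: g_simps sym[of V' U'] sym[of W' U'] sym[of W' V'])
    have "2 * pairing (dorfman br H u v) w =
        g W (br (U + U') (V + V')) - g W' (br (U + U') (V + V'))
        - (g V (br (U + U') (W + W')) - g V' (br (U + U') (W + W')))
        + (g U (br (V + V') (W + W')) - g U' (br (V + V') (W + W')))
        + H (U + U') (V + V') (W + W')"
      unfolding pairing_dorfman UVW fst snd by simp
    also have "\<dots> = 2 * (g (half_connection a u v) W - g (half_connection a v u) W + g (half_connection a w u) V)
      - 2 * (g (m.half_connection b u v) W' - g (m.half_connection b v u) W' + g (m.half_connection b w u) V')"
      using plus minus unfolding skews H_skews br_simps g_simps H_simps sym[of _ "br _ _"] by argo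
    also have "\<dots> = 2 * (pairing (D u v) w - pairing (D v u) w + pairing (D w u) v)"
      by (simp add: pairing_eq proj_D) (simp add: UVW proj_lift_add)
    finally show "pairing (torsion br H D u v) w = pairing 0 w"
      unfolding pairing_torsion[OF bil] by (simp add: pairing_simps)
  qed
  \<comment> \<open>A half connection sees its second argument only through the component in its own
    eigenbundle, so D preserves both eigenbundles.\<close>
  have half0: "half_connection a u (lift (- g) X) = 0" "m.half_connection b u (lift g X) = 0" for u X
    by (simp_all add: half_connection_def m.half_connection_def proj_lift_uminus proj_uminus_lift
        uminus_uminus_form zero_r bilinear_rzero[OF bilinear_nabla] bilinear_rzero[OF bilinear_balanced]
        bilinear_rzero[OF m.bilinear_nabla] bilinear_rzero[OF m.bilinear_balanced])
  have range: "D u (lift g X) \<in> range (lift g)" "D u (lift (- g) X) \<in> range (lift (- g))" for u X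
    by (simp_all add: D_def half0 linear_0[OF linear_lift] linear_0[OF m.linear_lift])
  have "levi_civita br H g D"
    unfolding levi_civita_def gen_connection_def E_plus_eq E_minus_eq
    using bil skew torsion range by (simp add: image_subset_iff)
  moreover have "divergence D = \<delta>"
  proof
    fix v
    have "divergence D v = \<delta> (lift g (proj g v)) + \<delta> (lift (- g) (proj (- g) v))"
      unfolding divergence_def trace_on_gen[OF bilinear_linear(2)[OF bil]] proj_D
      by (simp add: a_def b_def trace_half_connection[OF assms] m.trace_half_connection[OF assms])
    also have "\<dots> = \<delta> v" by (simp add: lift_proj flip: linear_add[OF \<delta>])
    finally show "divergence D v = \<delta> v" .
  qed
  ultimately show ?thesis by blast
qed

section \<open>The Einstein equations as equations on the Lie algebra\<close>

lemma ricci_plus_lift: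
  assumes \<delta>: "linear \<delta>" and dim: "DIM('a) \<noteq> 1"
  shows "ricci_plus br H g \<delta> (lift (- g) X) (lift g Y) = \<delta> (lift g (nabla br g H X Y))
    - trace_on UNIV (\<lambda>Z. nabla br g H (nabla br (- g) H Z X) Y)"
proof -
  have "levi_civita br H g (lc_with_divergence br H g \<delta>)" "divergence (lc_with_divergence br H g \<delta>) = \<delta>"
    using someI_ex[OF ex_levi_civita[OF assms]] unfolding lc_with_divergence_def by blast+
  then show ?thesis by (simp only: ricci_plus_def trace_curvature)
qed

text \<open>Since \<open>g\<close> and \<open>- g\<close> have the same Levi-Civita connections,
  \<open>SOME\<close> selects the same D for both.\<close>

lemma ricci_minus_eq: "ricci_minus br H g \<delta> = ricci_plus br H (- g) \<delta>"
proof -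
  interpret m: metric_algebra br "- g" H by (rule metric_algebra_uminus)
  show ?thesis
    by (intro ext) (simp add: ricci_minus_def ricci_plus_def lc_with_divergence_def levi_civita_uminus
        E_minus_eq m.E_plus_eq)
qed

lemma generalized_einstein_iff:
  assumes dim: "DIM('a) \<noteq> 1"
  shows "generalized_einstein br H g \<delta> \<longleftrightarrow> linear \<delta> \<and>
    (\<forall>X Y. \<delta> (lift g (nabla br g H X Y)) = trace_on UNIV (\<lambda>Z. nabla br g H (nabla br g (- H) Z X) Y)) \<and>
    (\<forall>X Y. \<delta> (lift (- g) (nabla br g (- H) X Y)) = trace_on UNIV (\<lambda>Z. nabla br g (- H) (nabla br g H Z X) Y))"
proof -
  interpret m: metric_algebra br "- g" H by (rule metric_algebra_uminus)
  show ?thesis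
    unfolding generalized_einstein_def ricci_minus_eq E_plus_eq E_minus_eq ball_simps(9)
    using ricci_plus_lift[OF _ dim, of \<delta>]
      m.ricci_plus_lift[OF _ dim, of \<delta>, unfolded uminus_uminus_form nabla_uminus]
    by (simp add: form pm nabla_uminus cong: conj_cong)
qed

end

section \<open>Null frames\<close>

text \<open>Here \<open>l\<close> and \<open>n\<close> span a hyperbolic plane and \<epsilon> is 1
  or -1, so both signatures (2,1) and (1,2) are covered.\<close>

locale null_basis = pmetric g
  for g :: "'a::euclidean_space \<Rightarrow> 'a \<Rightarrow> real" +
  fixes l n e :: 'a and \<epsilon> :: real
  assumes dim: "DIM('a) = 3"
    and g_ll: "g l l = 0" and g_ln: "g l n = 1" and g_le: "g l e = 0"
    and g_nn: "g n n = 0" and g_ne: "g n e = 0" and g_ee: "g e e = \<epsilon>" and eps: "\<epsilon> * \<epsilon> = 1"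
begin

text \<open>Pairing a vanishing combination with \<open>n\<close>, \<open>l\<close> and
  \<open>e\<close> isolates its coefficients; three independent vectors span in dimension 3.\<close>

lemma frame_expansion:
  obtains x y z where "V = x *\<^sub>R l + y *\<^sub>R n + z *\<^sub>R e"
proof -
  define T where "T = (\<lambda>(x, y, z). x *\<^sub>R l + y *\<^sub>R n + z *\<^sub>R e)"
  have "linear T"
    by (auto intro!: linearI simp: T_def algebra_simps)
  moreover have "inj T"
  proof (subst linear_injective_0[OF \<open>linear T\<close>], safe)
    fix x y z assume "T (x, y, z) = 0"
    then have 0: "x *\<^sub>R l + y *\<^sub>R n + z *\<^sub>R e = 0" by (simp add: T_def)
    have "g (x *\<^sub>R l + y *\<^sub>R n + z *\<^sub>R e) n = 0" "g (x *\<^sub>R l + y *\<^sub>R n + z *\<^sub>R e) l = 0"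
      "g (x *\<^sub>R l + y *\<^sub>R n + z *\<^sub>R e) e = 0"
      unfolding 0 by (simp_all add: zero_l)
    then show "(x, y, z) = 0"
      using eps by (auto simp: zero_prod_def g_simps g_ll g_ln g_le g_nn g_ne g_ee sym[of n l] sym[of e l] sym[of e n])
  qed
  moreover have "dim (UNIV :: (real \<times> real \<times> real) set) = dim (UNIV :: 'a set)"
    by (simp add: dim)
  ultimately have "surj T"
    by (metis linear_injective_imp_surjective)
  then obtain p where "T p = V" by (metis surjD)
  then show ?thesis using that by (cases p) (auto simp: T_def)
qed

text \<open>Because \<open>l\<close> and \<open>n\<close> are null with g(l, n) = 1, each represents
  the form dual to the other; the form dual to \<open>e\<close> acquires the sign
  \<epsilon>.\<close>

lemma trace_frame:
  assumes f: "linear f"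
  shows "trace_on UNIV f = g (f l) n + g (f n) l + \<epsilon> * g (f e) e"
proof -
  let ?e = "\<lambda>i::nat. if i = 0 then l else if i = 1 then n else e"
  let ?\<phi> = "\<lambda>(i::nat) V. if i = 0 then g V n else if i = 1 then g V l else \<epsilon> * g V e"
  have "trace_on UNIV f = (\<Sum>i\<in>{0, 1, 2}. ?\<phi> i (f (?e i)))"
  proof (rule trace_on_eq[OF _ f])
    have "V \<in> span (?e ` {0, 1, 2})" for V
    proof -
      have "l \<in> span (?e ` {0, 1, 2})" "n \<in> span (?e ` {0, 1, 2})" "e \<in> span (?e ` {0, 1, 2})"
        by (auto intro!: span_base)
      moreover obtain x y z where "V = x *\<^sub>R l + y *\<^sub>R n + z *\<^sub>R e" by (rule frame_expansion)
      ultimately show ?thesis by (simp add: span_add span_scale)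
    qed
    then show "span (?e ` {0, 1, 2}) = UNIV" by blast
    show "linear (?\<phi> i)" for i
      by (auto intro!: linearI simp: g_simps algebra_simps)
    show "?\<phi> i (?e j) = (if i = j then 1 else 0)" if "i \<in> {0, 1, 2}" "j \<in> {0, 1, 2}" for i j
      using that
      by (auto simp: g_ll g_ln g_le g_nn g_ne g_ee eps sym[of n l] sym[of e l] sym[of e n])
  qed auto
  then show ?thesis by simp
qed

lemma g_table:
  "g l l = 0" "g l n = 1" "g l e = 0" "g n l = 1" "g n n = 0" "g n e = 0" "g e l = 0" "g e n = 0" "g e e = \<epsilon>"
  by (simp_all add: g_ll g_ln g_le g_nn g_ne g_ee sym[of n l] sym[of e l] sym[of e n])

end

text \<open>The factors 2 keep fractions out of the table of \<open>nabla\<close>.\<close>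

locale null_frame = metric_algebra br g H + null_basis g l n e \<epsilon>
  for br :: "'a::euclidean_space \<Rightarrow> 'a \<Rightarrow> 'a" and g H l n e \<epsilon> +
  fixes a b c d h :: real
  assumes br_ln: "br l n = a *\<^sub>R n + (2 * b) *\<^sub>R e"
    and br_le: "br l e = c *\<^sub>R n + d *\<^sub>R e"
    and br_ne: "br n e = 0"
    and H_lne: "H l n e = 2 * h"
begin

lemma br_table:
  "br l l = 0" "br n n = 0" "br e e = 0"
  "br l n = a *\<^sub>R n + (2 * b) *\<^sub>R e" "br n l = - (a *\<^sub>R n + (2 * b) *\<^sub>R e)"
  "br l e = c *\<^sub>R n + d *\<^sub>R e" "br e l = - (c *\<^sub>R n + d *\<^sub>R e)" "br n e = 0" "br e n = 0"
  using br_skew[of l n] br_skew[of l e] br_skew[of n e]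
  by (simp_all add: br_self br_ln br_le br_ne)

lemma H_table:
  "H X X Y = 0" "H X Y Y = 0" "H X Y X = 0"
  "H l n e = 2 * h" "H n e l = 2 * h" "H e l n = 2 * h"
  "H n l e = - (2 * h)" "H l e n = - (2 * h)" "H e n l = - (2 * h)"
proof -
  show "H X X Y = 0" "H X Y Y = 0" "H X Y X = 0" using form by (auto simp: three_form_def)
  show 1: "H l n e = 2 * h" by (rule H_lne)
  show 2: "H n l e = - (2 * h)" using 1 H_skew(1)[of l n e] by simp
  show 3: "H l e n = - (2 * h)" using 1 H_skew(2)[of l n e] by simp
  show 4: "H e l n = 2 * h" using 3 H_skew(1)[of l e n] by simp
  show 5: "H n e l = 2 * h" using 2 H_skew(2)[of n l e] by simp
  show "H e n l = - (2 * h)" using 5 H_skew(1)[of n e l] by simp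
qed

lemma eps_left: "\<epsilon> * (\<epsilon> * x) = x"
  using eps by (simp flip: mult.assoc)

lemma nabla_frameI:
  assumes "\<And>Z. Z \<in> {l, n, e} \<Longrightarrow> 2 * g W Z = g (br X Y) Z - g (br X Z) Y - g (br Y Z) X + H X Y Z"
  shows "nabla br g H X Y = W"
proof (rule nablaI)
  fix Z
  obtain x y z where Z: "Z = x *\<^sub>R l + y *\<^sub>R n + z *\<^sub>R e" by (rule frame_expansion)
  let ?F = "\<lambda>Z. 2 * g W Z - (g (br X Y) Z - g (br X Z) Y - g (br Y Z) X + H X Y Z)"
  have "?F Z = x * ?F l + y * ?F n + z * ?F e"
    unfolding Z by (simp add: g_simps br_simps H_simps algebra_simps)
  moreover have "?F l = 0" "?F n = 0" "?F e = 0" using assms by simp_all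
  ultimately show "2 * g W Z = g (br X Y) Z - g (br X Z) Y - g (br Y Z) X + H X Y Z" by simp
qed

text \<open>In \<open>p\<close> and \<open>q\<close> the three-form enters with opposite signs, so
  passing from H to \<open>- H\<close> exchanges them.\<close>

definition "p = \<epsilon> * b + h"
definition "q = \<epsilon> * b - h"

lemma nabla_table:
  "nabla br g H l l = (- a) *\<^sub>R l + (- \<epsilon> * c) *\<^sub>R e"
  "nabla br g H l n = a *\<^sub>R n + (\<epsilon> * p) *\<^sub>R e"
  "nabla br g H l e = c *\<^sub>R n + (- p) *\<^sub>R l"
  "nabla br g H n l = (- \<epsilon> * p) *\<^sub>R e"
  "nabla br g H n n = 0"
  "nabla br g H n e = p *\<^sub>R n"
  "nabla br g H e l = (- q) *\<^sub>R l + (- d) *\<^sub>R e"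
  "nabla br g H e n = q *\<^sub>R n"
  "nabla br g H e e = (\<epsilon> * d) *\<^sub>R n"
  by (rule nabla_frameI; elim insertE emptyE;
      simp add: g_simps g_table br_table H_table p_def q_def eps eps_left algebra_simps)+

lemma null_frame_uminus: "null_frame br g (- H) l n e \<epsilon> a b c d (- h)"
  using three_form_uminus
  by unfold_locales
    (simp_all add: bilinear_br br_self dim g_table br_table H_table eps)

text \<open>Six pairs of frame vectors suffice. If \<open>F n\<close> were non-zero, the pairs (n,
  e) and (e, n) would give p = q = 0, and the remaining equations would force a = d = 0. With
  \<open>F n = 0\<close> the sum of the squares of \<open>p\<close> and \<open>q\<close>
  vanishes.\<close>

lemma einstein_frame:
  assumes F: "linear F" and ad: "a + d \<noteq> 0"
    and E: "\<And>X Y. F (nabla br g H X Y) = trace_on UNIV (\<lambda>Z. nabla br g H (nabla br g (- H) Z X) Y)"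
  shows "b = 0" "h = 0" "\<exists>X. F X \<noteq> 0"
proof -
  interpret m: null_frame br g "- H" l n e \<epsilon> a b c d "- h" by (rule null_frame_uminus)
  have mpq: "m.p = q" "m.q = p" by (simp_all add: m.p_def m.q_def p_def q_def)
  have lin: "linear (\<lambda>Z. nabla br g H (nabla br g (- H) Z X) Y)" for X Y
    using linear_compose[OF bilinear_linear(2)[OF m.bilinear_nabla] bilinear_linear(2)[OF bilinear_nabla]]
    by (simp add: o_def)
  note N_simps = bilinear_ladd[OF bilinear_nabla] bilinear_lmul[OF bilinear_nabla]
    bilinear_lzero[OF bilinear_nabla] bilinear_lneg[OF bilinear_nabla] bilinear_lsub[OF bilinear_nabla]
  note E' = E[unfolded trace_frame[OF lin]]
  note simps = nabla_table m.nabla_table[unfolded mpq] N_simps linear_add[OF F] linear_scale[OF F]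
    linear_0[OF F] linear_neg[OF F] linear_diff[OF F] g_simps g_table eps eps_left
  have ne: "p * F n = 0" using E'[of n e] by (simp add: simps)
  have en: "q * F n = 0" using E'[of e n] by (simp add: simps)
  have ln: "a * F n + \<epsilon> * p * F e = - \<epsilon> * (p * p + q * q)"
    using E'[of l n] by (simp add: simps algebra_simps)
  have nl: "- \<epsilon> * p * F e = - \<epsilon> * (p * p + q * q)"
    using E'[of n l] by (simp add: simps algebra_simps)
  have ee: "\<epsilon> * d * F n = 2 * p * q"
    using E'[of e e] by (simp add: simps algebra_simps)
  have ll: "- a * F l - \<epsilon> * c * F e = a * a + d * d + \<epsilon> * c * (p + q)"
    using E'[of l l] by (simp add: simps algebra_simps)
  \<comment> \<open>The pairs (l, n) and (n, l) combine so as to eliminate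
    \<open>F e\<close>.\<close>
  have aF: "a * F n = - 2 * \<epsilon> * (p * p + q * q)" using ln nl by argo
  have Fn: "F n = 0"
  proof (rule ccontr)
    assume "F n \<noteq> 0"
    with ne en have "p = 0" "q = 0" by auto
    with aF ee \<open>F n \<noteq> 0\<close> eps have "a = 0" "d = 0" by auto
    with ad show False by simp
  qed
  have "\<epsilon> \<noteq> 0" using eps by auto
  with aF Fn have "p * p + q * q = 0" by simp
  then have pq: "p = 0" "q = 0" by (simp_all add: sum_squares_eq_zero_iff)
  then show "h = 0" "b = 0" using \<open>\<epsilon> \<noteq> 0\<close> by (auto simp: p_def q_def)
  \<comment> \<open>With p = q = 0 this is the right-hand side of \<open>ll\<close>, so F cannot
    vanish on both \<open>l\<close> and \<open>e\<close>.\<close>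
  have "a * a + d * d \<noteq> 0" using ad by (auto simp: sum_squares_eq_zero_iff)
  with ll pq have "F l \<noteq> 0 \<or> F e \<noteq> 0" by auto
  then show "\<exists>X. F X \<noteq> 0" by auto
qed

lemma H_eq_0:
  assumes "h = 0"
  shows "H X Y Z = 0"
proof -
  obtain x y z where X: "X = x *\<^sub>R l + y *\<^sub>R n + z *\<^sub>R e" by (rule frame_expansion)
  obtain x' y' z' where Y: "Y = x' *\<^sub>R l + y' *\<^sub>R n + z' *\<^sub>R e" by (rule frame_expansion)
  obtain x'' y'' z'' where Z: "Z = x'' *\<^sub>R l + y'' *\<^sub>R n + z'' *\<^sub>R e" by (rule frame_expansion)
  show ?thesis unfolding X Y Z by (simp add: H_simps H_table assms)
qed

text \<open>With p = q = 0 both sides depend only on the \<open>l\<close> coefficients of X and Y.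
  The whole system reduces to the pair (l, l), which is the condition on \<alpha>.\<close>

lemma einstein_frame_exists:
  assumes "b = 0" "h = 0" and \<alpha>: "a * \<alpha> = - (a * a + d * d)"
  shows "\<alpha> * g (nabla br g H X Y) n = trace_on UNIV (\<lambda>Z. nabla br g H (nabla br g (- H) Z X) Y)"
proof -
  interpret m: null_frame br g "- H" l n e \<epsilon> a b c d "- h" by (rule null_frame_uminus)
  have pq: "p = 0" "q = 0" "m.p = 0" "m.q = 0"
    unfolding m.p_def m.q_def p_def q_def using assms by simp_all
  have lin: "linear (\<lambda>Z. nabla br g H (nabla br g (- H) Z X) Y)"
    using linear_compose[OF bilinear_linear(2)[OF m.bilinear_nabla] bilinear_linear(2)[OF bilinear_nabla]]
    by (simp add: o_def)
  note N_simps = bilinear_ladd[OF bilinear_nabla] bilinear_lmul[OF bilinear_nabla]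
    bilinear_lzero[OF bilinear_nabla] bilinear_lneg[OF bilinear_nabla] bilinear_lsub[OF bilinear_nabla]
    bilinear_radd[OF bilinear_nabla] bilinear_rmul[OF bilinear_nabla]
    bilinear_ladd[OF m.bilinear_nabla] bilinear_lmul[OF m.bilinear_nabla]
    bilinear_radd[OF m.bilinear_nabla] bilinear_rmul[OF m.bilinear_nabla]
  obtain x y z where X: "X = x *\<^sub>R l + y *\<^sub>R n + z *\<^sub>R e" by (rule frame_expansion)
  obtain x' y' z' where Y: "Y = x' *\<^sub>R l + y' *\<^sub>R n + z' *\<^sub>R e" by (rule frame_expansion)
  have "\<alpha> * g (nabla br g H X Y) n = - (a * \<alpha>) * (x * x')"
    unfolding X Y by (simp add: N_simps nabla_table pq g_simps g_table)
  also have "\<dots> = trace_on UNIV (\<lambda>Z. nabla br g H (nabla br g (- H) Z X) Y)"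
    unfolding trace_frame[OF lin] unfolding X Y \<alpha>
    by (simp add: N_simps nabla_table m.nabla_table pq g_simps g_table eps eps_left algebra_simps)
  finally show ?thesis .
qed

end

section \<open>Semidirect products\<close>

lemma char_poly_2_eq_0:
  fixes a b c d r x y :: "'a::comm_ring_1"
  assumes 1: "a * x + b * y = r * x" and 2: "c * x + d * y = r * y"
  shows "((r - a) * (r - d) - b * c) * x = 0" and "((r - a) * (r - d) - b * c) * y = 0"
proof -
  have *: "r * x - a * x = b * y" "r * y - d * y = c * x"
    unfolding 1[symmetric] 2[symmetric] by simp_all
  have "((r - a) * (r - d) - b * c) * x = (r - d) * (r * x - a * x) - b * (c * x)"
    by (simp add: algebra_simps)
  also have "\<dots> = b * (r * y - d * y) - b * (c * x)"
    unfolding *(1) by (simp add: algebra_simps)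
  finally show "((r - a) * (r - d) - b * c) * x = 0" by (simp add: *(2))
  have "((r - a) * (r - d) - b * c) * y = (r - a) * (r * y - d * y) - c * (b * y)"
    by (simp add: algebra_simps)
  also have "\<dots> = c * (r * x - a * x) - c * (b * y)"
    unfolding *(2) by (simp add: algebra_simps)
  finally show "((r - a) * (r - d) - b * c) * y = 0" by (simp add: *(1))
qed

lemma real_eigenvector_imp_has_real_eigenvalues:
  fixes M :: "real^2^2"
  assumes v: "v \<noteq> 0" "M *v v = r *\<^sub>R v"
  shows "has_real_eigenvalues M"
  unfolding has_real_eigenvalues_def
proof (intro allI impI)
  fix z :: complex
  assume "\<exists>w::complex^2. w \<noteq> 0 \<and> map_matrix complex_of_real M *v w = z *s w"
  then obtain w :: "complex^2" where w: "w \<noteq> 0" "map_matrix complex_of_real M *v w = z *s w" by blast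
  define a b c d where abcd: "a = M $ 1 $ 1" "b = M $ 1 $ 2" "c = M $ 2 $ 1" "d = M $ 2 $ 2"
  have "a * v $ 1 + b * v $ 2 = r * v $ 1" "c * v $ 1 + d * v $ 2 = r * v $ 2"
    using v(2) by (simp_all add: vec_eq_iff matrix_vector_mult_def sum_2 forall_2 abcd)
  then have "((r - a) * (r - d) - b * c) * v $ 1 = 0" "((r - a) * (r - d) - b * c) * v $ 2 = 0"
    by (rule char_poly_2_eq_0)+
  moreover have "v $ 1 \<noteq> 0 \<or> v $ 2 \<noteq> 0" using v(1) by (simp add: vec_eq_iff forall_2)
  ultimately have "(r - a) * (r - d) - b * c = 0" by auto
  then have "complex_of_real ((r - a) * (r - d) - b * c) = 0" by (metis of_real_0)
  then have r: "(of_real r - of_real a) * (of_real r - of_real d) - of_real b * of_real c = (0 :: complex)"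
    by simp
  have "of_real a * w $ 1 + of_real b * w $ 2 = z * w $ 1" "of_real c * w $ 1 + of_real d * w $ 2 = z * w $ 2"
    using w(2) by (simp_all add: vec_eq_iff matrix_vector_mult_def sum_2 forall_2 abcd)
  then have "((z - of_real a) * (z - of_real d) - of_real b * of_real c) * w $ 1 = 0"
    "((z - of_real a) * (z - of_real d) - of_real b * of_real c) * w $ 2 = 0"
    by (rule char_poly_2_eq_0)+
  moreover have "w $ 1 \<noteq> 0 \<or> w $ 2 \<noteq> 0" using w(1) by (simp add: vec_eq_iff forall_2)
  ultimately have "(z - of_real a) * (z - of_real d) - of_real b * of_real c = 0" by auto
  \<comment> \<open>The difference of the characteristic equations for z and r factors; the second
    root is the trace minus r, again real.\<close>
  then have "(z - of_real r) * (z - (of_real a + of_real d - of_real r)) = 0"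
    using r by algebra
  then have "z = of_real r \<or> z = of_real a + of_real d - of_real r"
    unfolding mult_eq_0_iff right_minus_eq .
  then show "z \<in> \<real>" by auto
qed

text \<open>\<open>D\<close> is the discriminant of the characteristic polynomial. It is
  non-negative, and the quadratic formula then gives real roots, of which a non-zero one is
  selected.\<close>

lemma has_real_eigenvalues_imp_eigenvector:
  fixes M :: "real^2^2"
  assumes M: "has_real_eigenvalues M" and tr: "trace M \<noteq> 0"
  obtains r v where "r \<noteq> 0" "v \<noteq> 0" "M *v v = r *\<^sub>R v"
proof -
  define a b c d where abcd: "a = M $ 1 $ 1" "b = M $ 1 $ 2" "c = M $ 2 $ 1" "d = M $ 2 $ 2"
  define D where "D = (a - d)\<^sup>2 + 4 * b * c"
  have D: "D \<ge> 0"
  proof (rule ccontr)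
    assume neg: "\<not> D \<ge> 0"
    then have b: "b \<noteq> 0" by (auto simp: D_def)
    \<comment> \<open>A non-real root of the characteristic polynomial. The vector \<open>w\<close>
      solves the first row of the eigenvalue equation identically; the second row is the
      characteristic equation.\<close>
    define z where "z = Complex ((a + d) / 2) (sqrt (- D) / 2)"
    define w :: "complex^2" where "w = vector [of_real b, z - of_real a]"
    have "of_real (sqrt (- D)) * of_real (sqrt (- D)) = complex_of_real (- D)"
      using neg by (simp flip: of_real_mult)
    moreover have "2 * z = of_real (a + d) + \<i> * of_real (sqrt (- D))"
      by (simp add: z_def complex_eq_iff)
    ultimately have "(2 * z - of_real (a + d)) * (2 * z - of_real (a + d)) = of_real D"
      by (simp add: algebra_simps)
    then have "4 * (z * z) = 4 * (of_real (a + d) * z - of_real (a * d - b * c))"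
      by (simp add: D_def power2_eq_square algebra_simps)
    then have z: "z * z = of_real (a + d) * z - of_real (a * d - b * c)"
      by (rule mult_left_cancel[THEN iffD1, rotated]) simp
    have "map_matrix complex_of_real M *v w = z *s w"
      using z by (simp add: vec_eq_iff matrix_vector_mult_def sum_2 forall_2 w_def abcd algebra_simps)
    moreover have "w \<noteq> 0" using b by (simp add: vec_eq_iff forall_2 w_def)
    ultimately have "z \<in> \<real>" using M by (auto simp: has_real_eigenvalues_def)
    then show False using neg by (simp add: z_def complex_is_Real_iff)
  qed
  \<comment> \<open>Giving the square root the sign of the trace prevents cancellation, so this root
    is non-zero.\<close>
  define r where "r = (if a + d > 0 then (a + d + sqrt D) / 2 else (a + d - sqrt D) / 2)"
  have "a + d \<noteq> 0" using tr by (simp add: trace_def sum_2 abcd)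
  then have "a + d + sqrt D > 0 \<and> a + d > 0 \<or> a + d - sqrt D < 0 \<and> \<not> a + d > 0"
    using real_sqrt_ge_zero[OF D] by linarith
  then have r0: "r \<noteq> 0" by (auto simp: r_def)
  have "(2 * r - (a + d)) * (2 * r - (a + d)) = D"
  proof -
    have "2 * r - (a + d) = sqrt D \<or> 2 * r - (a + d) = - sqrt D"
      by (simp add: r_def field_simps)
    then show ?thesis using D by (elim disjE) (simp_all only: minus_mult_minus real_sqrt_mult_self abs_of_nonneg)
  qed
  then have r: "r * r = (a + d) * r - (a * d - b * c)"
    by (simp add: D_def power2_eq_square algebra_simps)
  have ev: "M *v v = r *\<^sub>R v \<longleftrightarrow> a * v $ 1 + b * v $ 2 = r * v $ 1 \<and> c * v $ 1 + d * v $ 2 = r * v $ 2" for v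
    by (simp add: vec_eq_iff matrix_vector_mult_def sum_2 forall_2 abcd)
  \<comment> \<open>Each row of M - r yields a candidate eigenvector; if both candidates vanish, M
    is r times the identity.\<close>
  have 1: "M *v vector [b, r - a] = r *\<^sub>R vector [b, r - a]"
    and 2: "M *v vector [r - d, c] = r *\<^sub>R vector [r - d, c]"
    using r by (simp_all add: ev algebra_simps)
  show ?thesis
  proof (cases "(vector [b, r - a] :: real^2) = 0 \<and> (vector [r - d, c] :: real^2) = 0")
    case True
    then have "M *v vector [1, 0] = r *\<^sub>R vector [1, 0]"
      unfolding ev by (simp add: vec_eq_iff forall_2)
    moreover have "(vector [1, 0] :: real^2) \<noteq> 0" by (simp add: vec_eq_iff forall_2)
    ultimately show ?thesis using that r0 by blast
  next
    case False
    then show ?thesis using that r0 1 2 by blast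
  qed
qed

section \<open>Coordinates on a semidirect product\<close>

lemma linear_inverse:
  assumes "linear f" "\<And>x. k (f x) = x" "\<And>y. f (k y) = y"
  shows "linear k"
proof (rule linearI)
  show "k (x + y) = k x + k y" for x y
    using assms(2)[of "k x + k y"] by (simp add: linear_add[OF assms(1)] assms(3))
  show "k (r *\<^sub>R x) = r *\<^sub>R k x" for r x
    using assms(2)[of "r *\<^sub>R k x"] by (simp add: linear_scale[OF assms(1)] assms(3))
qed

locale semidirect =
  fixes br :: "'a::euclidean_space \<Rightarrow> 'a \<Rightarrow> 'a" and M :: "real^2^2"
    and \<phi> :: "'a \<Rightarrow> real \<times> (real^2)"
  assumes linear_\<phi>: "linear \<phi>" and bij_\<phi>: "bij \<phi>"
    and hom: "\<phi> (br X Y) = semidirect_bracket M (\<phi> X) (\<phi> Y)"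
begin

definition "\<psi> = inv \<phi>"

lemma \<psi>\<phi>: "\<psi> (\<phi> X) = X" and \<phi>\<psi>: "\<phi> (\<psi> y) = y"
  using bij_\<phi> by (auto simp: \<psi>_def bij_def surj_f_inv_f)

lemma linear_\<psi>: "linear \<psi>"
  using linear_inverse[OF linear_\<phi>] \<psi>\<phi> \<phi>\<psi> by blast

lemma br_eq: "br X Y = \<psi> (0, fst (\<phi> X) *\<^sub>R (M *v snd (\<phi> Y)) - fst (\<phi> Y) *\<^sub>R (M *v snd (\<phi> X)))"
  by (metis (no_types, lifting) \<psi>\<phi> hom semidirect_bracket_def split_beta)

lemma fst_br: "fst (\<phi> (br X Y)) = 0"
  by (simp add: br_eq \<phi>\<psi>)

lemma br_kernel: "fst (\<phi> X) = 0 \<Longrightarrow> fst (\<phi> Y) = 0 \<Longrightarrow> br X Y = 0"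
  by (simp add: br_eq linear_0[OF linear_\<psi>] flip: zero_prod_def)

lemma linear_br: "linear (br X)"
proof -
  have "linear (\<lambda>Y. (0::real, fst (\<phi> X) *\<^sub>R (M *v snd (\<phi> Y)) - fst (\<phi> Y) *\<^sub>R (M *v snd (\<phi> X))))"
    by (rule linearI)
      (simp_all add: linear_add[OF linear_\<phi>] linear_scale[OF linear_\<phi>] matrix_vector_right_distrib
        scaleR_add_left scaleR_add_right scaleR_diff_right matrix_vector_mult_scaleR ac_simps)
  from linear_compose[OF this linear_\<psi>] show ?thesis
    by (simp add: o_def flip: br_eq)
qed

text \<open>The image of \<open>br X\<close> lies in the plane factor, on which \<open>br X\<close>
  acts as \<open>fst (\<phi> X)\<close> times M. So the plane factor is the unimodular kernel once M
  has non-zero trace.\<close>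

lemma trace_br: "trace_on UNIV (br X) = fst (\<phi> X) * trace M"
proof -
  let ?b = "\<lambda>i::nat. if i = 0 then (1, 0) else if i = 1 then (0, vector [1, 0]) else (0::real, vector [0, 1] :: real^2)"
  let ?c = "\<lambda>(i::nat) Y. if i = 0 then fst (\<phi> Y) else if i = 1 then snd (\<phi> Y) $ 1 else snd (\<phi> Y) $ 2"
  have "trace_on UNIV (br X) = (\<Sum>i\<in>{0, 1, 2}. ?c i (br X (\<psi> (?b i))))"
  proof (rule trace_on_eq[OF _ linear_br])
    have "V \<in> span ((\<lambda>i. \<psi> (?b i)) ` {0, 1, 2})" for V
    proof -
      have "\<phi> V = fst (\<phi> V) *\<^sub>R ?b 0 + (snd (\<phi> V) $ 1) *\<^sub>R ?b 1 + (snd (\<phi> V) $ 2) *\<^sub>R ?b 2"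
        by (simp add: prod_eq_iff vec_eq_iff forall_2)
      then have "V = \<psi> (fst (\<phi> V) *\<^sub>R ?b 0 + (snd (\<phi> V) $ 1) *\<^sub>R ?b 1 + (snd (\<phi> V) $ 2) *\<^sub>R ?b 2)"
        by (metis \<psi>\<phi>)
      then have V: "V = fst (\<phi> V) *\<^sub>R \<psi> (?b 0) + (snd (\<phi> V) $ 1) *\<^sub>R \<psi> (?b 1) + (snd (\<phi> V) $ 2) *\<^sub>R \<psi> (?b 2)"
        by (simp only: linear_add[OF linear_\<psi>] linear_scale[OF linear_\<psi>])
      have "\<psi> (?b 0) \<in> span ((\<lambda>i. \<psi> (?b i)) ` {0, 1, 2})" "\<psi> (?b 1) \<in> span ((\<lambda>i. \<psi> (?b i)) ` {0, 1, 2})"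
        "\<psi> (?b 2) \<in> span ((\<lambda>i. \<psi> (?b i)) ` {0, 1, 2})"
        by (intro span_base imageI; simp)+
      then show ?thesis by (subst V) (intro span_add span_scale)
    qed
    then show "span ((\<lambda>i. \<psi> (?b i)) ` {0, 1, 2}) = UNIV" by blast
    show "linear (?c i)" for i
      by (auto intro!: linearI simp: linear_add[OF linear_\<phi>] linear_scale[OF linear_\<phi>])
    show "?c i (\<psi> (?b j)) = (if i = j then 1 else 0)" if "i \<in> {0, 1, 2}" "j \<in> {0, 1, 2}" for i j
      using that by (auto simp: \<phi>\<psi>)
  qed auto
  also have "\<dots> = fst (\<phi> X) * trace M"
    by (simp add: br_eq \<phi>\<psi> trace_def sum_2 matrix_vector_mult_def algebra_simps)
  finally show ?thesis .
qed

end

section \<open>The structure of three-dimensional non-unimodular Lie algebras\<close>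

lemma lie_isomorphic_semidirect_iff:
  "lie_isomorphic br (semidirect_bracket M) \<longleftrightarrow> (\<exists>\<phi>. semidirect br M \<phi>)"
  by (simp add: lie_isomorphic_def semidirect_def)

text \<open>The trace form \<tau> vanishes on brackets, so its kernel is a two-dimensional ideal
  containing them all. This ideal is abelian, and a complementary vector acts on it by M.\<close>

lemma ex_lie_isomorphic_semidirect:
  fixes br :: "'a::euclidean_space \<Rightarrow> 'a \<Rightarrow> 'a"
  assumes dim: "DIM('a) = 3" and lie: "lie_bracket br" and nonuni: "unimodular_kernel br \<noteq> UNIV"
  shows "\<exists>M. lie_isomorphic br (semidirect_bracket M)"
proof -
  have bil: "bilinear br" and self: "br X X = 0"
    and jacobi: "br X (br Y Z) + br Y (br Z X) + br Z (br X Y) = 0" for X Y Z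
    using lie by (auto simp: lie_bracket_def)
  have lin: "linear (br X)" "linear (\<lambda>X. br X Y)" for X Y using bil by (simp_all add: bilinear_def)
  note br_simps = bilinear_ladd[OF bil] bilinear_radd[OF bil] bilinear_lmul[OF bil] bilinear_rmul[OF bil]
  have skew: "br Y X = - br X Y" for X Y
  proof -
    have "br X X + br X Y + (br Y X + br Y Y) = 0"
      using self[of "X + Y"] unfolding br_simps by (simp add: algebra_simps)
    then show ?thesis by (simp add: self eq_neg_iff_add_eq_0 add.commute)
  qed
  define \<tau> where "\<tau> X = trace_on UNIV (br X)" for X
  have \<tau>: "\<tau> X = (\<Sum>i\<in>Basis. br X i \<bullet> i)" for X by (simp add: \<tau>_def trace_on_UNIV lin)
  have lin_\<tau>: "linear \<tau>"
    by (rule linearI) (simp_all add: \<tau> br_simps inner_add_left sum.distrib sum_distrib_left)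
  have \<tau>_br: "\<tau> (br X Y) = 0" for X Y
  proof -
    \<comment> \<open>The Jacobi identity turns the adjoint map of a bracket into a commutator,
      whose trace is zero.\<close>
    have eq: "br (br X Y) = (\<lambda>Z. br X (br Y Z) - br Y (br X Z))"
    proof
      fix Z
      have "br Y (br Z X) = - br Y (br X Z)" by (simp add: skew[of X Z] bilinear_rneg[OF bil])
      then show "br (br X Y) Z = br X (br Y Z) - br Y (br X Z)"
        using jacobi[of X Y Z] skew[of Z "br X Y"] by (simp add: algebra_simps)
    qed
    have "linear (\<lambda>Z. br X (br Y Z))" for X Y
      using linear_compose[OF lin(1) lin(1)] by (simp add: o_def)
    then show ?thesis
      using trace_on_UNIV_commute[OF lin(1)[of X] lin(1)[of Y]] by (simp add: \<tau>_def eq trace_on_UNIV_diff)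
  qed
  \<comment> \<open>The auxiliary inner product represents \<tau> by \<open>t\<close>, so
    \<open>e0\<close> below is a unit normal to the unimodular kernel.\<close>
  define t where "t = (\<Sum>i\<in>Basis. \<tau> i *\<^sub>R i)"
  have t: "\<tau> X = X \<bullet> t" for X
  proof -
    have "\<tau> X = \<tau> (\<Sum>i\<in>Basis. (X \<bullet> i) *\<^sub>R i)" by (simp add: euclidean_representation)
    then show ?thesis
      by (simp add: t_def linear_sum[OF lin_\<tau>] linear_scale[OF lin_\<tau>] inner_sum_right mult.commute)
  qed
  have "t \<noteq> 0" using nonuni t by (auto simp: unimodular_kernel_def \<tau>_def)
  define e0 where "e0 = t /\<^sub>R norm t"
  have t_e0: "t = norm t *\<^sub>R e0" using \<open>t \<noteq> 0\<close> by (simp add: e0_def)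
  have e00: "e0 \<bullet> e0 = 1" using \<open>t \<noteq> 0\<close> by (simp add: e0_def dot_square_norm power2_eq_square)
  let ?S = "{x. e0 \<bullet> x = 0}"
  have S: "X \<in> ?S \<longleftrightarrow> \<tau> X = 0" for X
  proof -
    have "\<tau> X = norm t * (e0 \<bullet> X)"
      unfolding t by (subst t_e0) (simp add: inner_commute)
    then show ?thesis using \<open>t \<noteq> 0\<close> by simp
  qed
  have "dim ?S = 2" using dim_hyperplane[of e0] e00 dim by force
  then obtain B where B: "B \<subseteq> ?S" "pairwise orthogonal B" "\<And>x. x \<in> B \<Longrightarrow> norm x = 1" "card B = 2" "span B = ?S"
    using orthonormal_basis_subspace[OF subspace_hyperplane[of e0]] by metis
  from \<open>card B = 2\<close> obtain e1 e2 where e12: "B = {e1, e2}" "e1 \<noteq> e2" by (meson card_2_iff)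
  have inner: "e0 \<bullet> e0 = 1" "e1 \<bullet> e1 = 1" "e2 \<bullet> e2 = 1" "e0 \<bullet> e1 = 0" "e0 \<bullet> e2 = 0" "e1 \<bullet> e2 = 0"
    "e1 \<bullet> e0 = 0" "e2 \<bullet> e0 = 0" "e2 \<bullet> e1 = 0"
    using B e12 e00
    by (auto simp: pairwise_def orthogonal_def inner_commute dot_square_norm)
  have expand: "X = (X \<bullet> e0) *\<^sub>R e0 + (X \<bullet> e1) *\<^sub>R e1 + (X \<bullet> e2) *\<^sub>R e2" for X
  proof -
    have "e0 \<bullet> (X - (X \<bullet> e0) *\<^sub>R e0) = 0" by (simp add: inner inner_diff_right inner_commute)
    then have "X - (X \<bullet> e0) *\<^sub>R e0 \<in> span {e1, e2}" using B(5) e12(1) by auto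
    then obtain x y where xy: "X - (X \<bullet> e0) *\<^sub>R e0 = x *\<^sub>R e1 + y *\<^sub>R e2"
      unfolding span_insert by (auto simp: algebra_simps)
    then have X: "X = (X \<bullet> e0) *\<^sub>R e0 + x *\<^sub>R e1 + y *\<^sub>R e2" by (simp add: algebra_simps)
    have "X \<bullet> e1 = x" "X \<bullet> e2 = y"
      by (subst X, simp add: inner inner_add_left)+
    then show ?thesis using X by metis
  qed
  have trace: "\<tau> X = br X e0 \<bullet> e0 + br X e1 \<bullet> e1 + br X e2 \<bullet> e2" for X
  proof -
    let ?e = "\<lambda>i::nat. if i = 0 then e0 else if i = 1 then e1 else e2"
    have "\<tau> X = (\<Sum>i\<in>{0, 1, 2}. br X (?e i) \<bullet> ?e i)"
      unfolding \<tau>_def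
    proof (rule trace_on_eq[OF _ lin(1)])
      have "V \<in> span (?e ` {0, 1, 2})" for V
      proof -
        have "e0 \<in> span (?e ` {0, 1, 2})" "e1 \<in> span (?e ` {0, 1, 2})" "e2 \<in> span (?e ` {0, 1, 2})"
          by (auto intro!: span_base)
        then show ?thesis by (subst expand[of V]) (intro span_add span_scale)
      qed
      then show "span (?e ` {0, 1, 2}) = UNIV" by blast
      show "linear (\<lambda>V. V \<bullet> ?e i)" for i
        by (rule bounded_linear.linear[OF bounded_linear_inner_left])
      show "?e j \<bullet> ?e i = (if i = j then 1 else 0)" if "i \<in> {0, 1, 2}" "j \<in> {0, 1, 2}" for i j
        using that by (auto simp: inner)
    qed auto
    then show ?thesis by simp
  qed
  have br_e0: "br X Y \<bullet> e0 = 0" for X Y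
    using \<tau>_br[of X Y] S[of "br X Y"] by (simp add: inner_commute[of e0])
  have \<tau>_e: "\<tau> e1 = 0" "\<tau> e2 = 0" using S[of e1] S[of e2] inner by auto
  \<comment> \<open>The traces for \<open>e1\<close> and \<open>e2\<close> reduce, up to sign, to
    the \<open>e2\<close> and \<open>e1\<close> coefficients of their bracket, and both traces
    vanish.\<close>
  have br12: "br e1 e2 = 0"
  proof -
    have "br e1 e2 \<bullet> e2 = 0" using \<tau>_e(1) by (simp add: trace br_e0 self)
    moreover have "br e1 e2 \<bullet> e1 = 0" using \<tau>_e(2) by (simp add: trace br_e0 self skew[of e1 e2])
    ultimately show ?thesis by (subst expand) (simp add: br_e0)
  qed
  have br21: "br e2 e1 = 0" using skew[of e1 e2] br12 by simp
  define M :: "real^2^2" where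
    "M = vector [vector [br e0 e1 \<bullet> e1, br e0 e2 \<bullet> e1], vector [br e0 e1 \<bullet> e2, br e0 e2 \<bullet> e2]]"
  define \<phi> :: "'a \<Rightarrow> real \<times> (real^2)" where "\<phi> X = (X \<bullet> e0, vector [X \<bullet> e1, X \<bullet> e2])" for X
  have "linear \<phi>"
    by (rule linearI) (simp_all add: \<phi>_def vec_eq_iff forall_2 inner_add_left)
  moreover have "bij \<phi>"
  proof (rule bijI')
    show "\<phi> X = \<phi> Y \<longleftrightarrow> X = Y" for X Y
    proof
      assume "\<phi> X = \<phi> Y"
      then have "X \<bullet> e0 = Y \<bullet> e0" "X \<bullet> e1 = Y \<bullet> e1" "X \<bullet> e2 = Y \<bullet> e2"
        by (simp_all add: \<phi>_def vec_eq_iff forall_2)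
      then show "X = Y" using expand[of X] expand[of Y] by metis
    qed simp
    show "\<exists>X. y = \<phi> X" for y
      by (rule exI[of _ "fst y *\<^sub>R e0 + (snd y $ 1) *\<^sub>R e1 + (snd y $ 2) *\<^sub>R e2"])
        (simp add: \<phi>_def prod_eq_iff vec_eq_iff forall_2 inner inner_add_left)
  qed
  moreover have "\<phi> (br X Y) = semidirect_bracket M (\<phi> X) (\<phi> Y)" for X Y
  proof -
    have "br X Y = br ((X \<bullet> e0) *\<^sub>R e0 + (X \<bullet> e1) *\<^sub>R e1 + (X \<bullet> e2) *\<^sub>R e2)
        ((Y \<bullet> e0) *\<^sub>R e0 + (Y \<bullet> e1) *\<^sub>R e1 + (Y \<bullet> e2) *\<^sub>R e2)"
      by (simp flip: expand)
    also have "\<dots> = (X \<bullet> e0) *\<^sub>R ((Y \<bullet> e1) *\<^sub>R br e0 e1 + (Y \<bullet> e2) *\<^sub>R br e0 e2)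
        - (Y \<bullet> e0) *\<^sub>R ((X \<bullet> e1) *\<^sub>R br e0 e1 + (X \<bullet> e2) *\<^sub>R br e0 e2)"
      unfolding br_simps
      by (simp add: self br12 br21 skew[of e0 e1] skew[of e0 e2] algebra_simps)
    finally have eq: "br X Y = (X \<bullet> e0) *\<^sub>R ((Y \<bullet> e1) *\<^sub>R br e0 e1 + (Y \<bullet> e2) *\<^sub>R br e0 e2)
        - (Y \<bullet> e0) *\<^sub>R ((X \<bullet> e1) *\<^sub>R br e0 e1 + (X \<bullet> e2) *\<^sub>R br e0 e2)" .
    show ?thesis
      by (simp add: eq \<phi>_def semidirect_bracket_def br_e0 vec_eq_iff forall_2 M_def matrix_vector_mult_def
          sum_2 inner_diff_left inner_add_left algebra_simps)
  qed
  ultimately show ?thesis unfolding lie_isomorphic_def by blast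
qed

section \<open>Degenerate generalized Einstein structures\<close>

text \<open>A vector \<open>n\<close> of the kernel orthogonal to the kernel is null, and its
  orthogonal complement is the kernel itself. It is completed by \<open>l\<close> to a hyperbolic
  plane; the complement of that plane is a non-degenerate line, which provides
  \<open>e\<close>.\<close>

lemma (in metric_algebra) ex_null_frame:
  assumes sd: "semidirect br M \<phi>" and dim: "DIM('a) = 3" and tr: "trace M \<noteq> 0"
    and deg: "degenerate_on g {X. fst (\<phi> X) = 0}"
  obtains l n e \<epsilon> a b c d h where "null_frame br g H l n e \<epsilon> a b c d h" "a + d \<noteq> 0"
    "fst (\<phi> n) = 0" "fst (\<phi> l) \<noteq> 0"
proof -
  interpret semidirect br M \<phi> by (rule sd)
  define L where "L X = fst (\<phi> X)" for X
  have lin_L: "linear L"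
    unfolding L_def by (rule linearI) (simp_all add: linear_add[OF linear_\<phi>] linear_scale[OF linear_\<phi>])
  obtain n where n: "L n = 0" "n \<noteq> 0" "\<And>Y. L Y = 0 \<Longrightarrow> g n Y = 0"
    using deg by (auto simp: degenerate_on_def L_def)
  obtain l0 where l0: "g n l0 \<noteq> 0" using nondegenerate n(2) by metis
  define l1 where "l1 = l0 /\<^sub>R g n l0"
  \<comment> \<open>As \<open>n\<close> is null and g(l1, n) = 1, this correction makes
    \<open>l\<close> null and keeps its product with \<open>n\<close>.\<close>
  define l where "l = l1 - (g l1 l1 / 2) *\<^sub>R n"
  have nn: "g n n = 0" using n by simp
  have nl1: "g n l1 = 1" "g l1 n = 1" using l0 by (simp_all add: l1_def g_simps sym[of l0 n])
  have ln: "g l n = 1" "g n l = 1" "g l l = 0"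
    using nn nl1 by (simp_all add: l_def g_simps)
  have Ll: "L l \<noteq> 0" using n(3) ln(2) by force
  \<comment> \<open>The orthogonal projection along the plane of \<open>l\<close> and
    \<open>n\<close>.\<close>
  define W where "W V = V - g V n *\<^sub>R l - g V l *\<^sub>R n" for V
  have W: "g (W V) l = 0" "g (W V) n = 0" for V
    by (simp_all add: W_def g_simps ln nn)
  have gW: "g U (W V) = g U V" if "g U l = 0" "g U n = 0" for U V
    using that by (simp add: W_def g_simps)
  obtain V where V: "V \<notin> span {l, n}"
  proof -
    have "dim (span {l, n}) \<le> 2"
      using dim_le_card'[of "{l, n}"] card_insert_le_m1[of 2 "{n}" l] by (simp add: dim_span)
    then have "span {l, n} \<noteq> UNIV" using dim by (metis Suc_n_not_le_n dim_UNIV numeral_2_eq_2 numeral_3_eq_3)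
    then show ?thesis using that by blast
  qed
  have "W V \<noteq> 0"
  proof
    assume "W V = 0"
    then have "V = g V n *\<^sub>R l + g V l *\<^sub>R n" by (simp add: W_def algebra_simps)
    moreover have "g V n *\<^sub>R l + g V l *\<^sub>R n \<in> span {l, n}"
      by (intro span_add span_scale span_base) auto
    ultimately show False using V by simp
  qed
  \<comment> \<open>Otherwise polarization makes \<open>W V\<close> orthogonal to every
    \<open>W Z\<close>, hence to everything.\<close>
  have "\<exists>U. g U l = 0 \<and> g U n = 0 \<and> g U U \<noteq> 0"
  proof (rule ccontr)
    assume "\<not> ?thesis"
    then have iso: "g U U = 0" if "g U l = 0" "g U n = 0" for U using that by blast
    have "g (W V) Z = 0" for Z
    proof -
      have "g (W V + W Z) (W V + W Z) = 0" by (rule iso) (simp_all add: g_simps W)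
      moreover have "g (W V) (W V) = 0" "g (W Z) (W Z) = 0" by (rule iso; simp add: W)+
      ultimately have "g (W V) (W Z) = 0" using sym[of "W Z" "W V"] by (simp add: g_simps)
      then show ?thesis by (simp add: gW W)
    qed
    then show False using nondegenerate \<open>W V \<noteq> 0\<close> by blast
  qed
  then obtain U where U: "g U l = 0" "g U n = 0" "g U U \<noteq> 0" by blast
  define e where "e = U /\<^sub>R sqrt \<bar>g U U\<bar>"
  define \<epsilon> where "\<epsilon> = sgn (g U U)"
  have e: "g e l = 0" "g e n = 0" "g e e = \<epsilon>"
    using U by (simp_all add: e_def \<epsilon>_def g_simps sgn_real_def field_simps)
  have eps: "\<epsilon> * \<epsilon> = 1" using U by (simp add: \<epsilon>_def sgn_real_def)
  \<comment> \<open>Subtracting a multiple of \<open>l\<close> moves \<open>e\<close> into the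
    kernel, which is orthogonal to \<open>n\<close>; since g(n, e) = 0 and g(n, l) = 1, that
    multiple is zero.\<close>
  have Le: "L e = 0"
  proof -
    have "L (e - (L e / L l) *\<^sub>R l) = 0" using Ll by (simp add: linear_diff[OF lin_L] linear_scale[OF lin_L])
    from n(3)[OF this] show ?thesis using Ll by (simp add: g_simps ln sym[of n e] e)
  qed
  interpret B: null_basis g l n e \<epsilon>
    by unfold_locales (use dim ln nn e eps in \<open>auto simp: sym[of l e] sym[of n e]\<close>)
  have coords: "\<exists>y z. V = y *\<^sub>R n + z *\<^sub>R e" if "L V = 0" for V
  proof -
    obtain x y z where V: "V = x *\<^sub>R l + y *\<^sub>R n + z *\<^sub>R e" by (rule B.frame_expansion)
    have "x * L l = 0" using that by (simp add: V linear_add[OF lin_L] linear_scale[OF lin_L] n Le)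
    then show ?thesis using V Ll by auto
  qed
  obtain a b where ab: "br l n = a *\<^sub>R n + b *\<^sub>R e" using coords[of "br l n"] fst_br by (auto simp: L_def)
  obtain c d where cd: "br l e = c *\<^sub>R n + d *\<^sub>R e" using coords[of "br l e"] fst_br by (auto simp: L_def)
  have "null_frame br g H l n e \<epsilon> a (b / 2) c d (H l n e / 2)"
    by unfold_locales (use ab cd br_kernel[of n e] n(1) Le in \<open>auto simp: L_def\<close>)
  \<comment> \<open>The trace of \<open>br l\<close> computed in the semidirect coordinates and in
    the null frame.\<close>
  moreover have "L l * trace M = a + d"
    using trace_br[of l] B.trace_frame[OF linear_br(1)[of l]]
    by (simp add: L_def ab cd br_self g_simps B.g_table mult.left_commute[of \<epsilon>] eps)
  then have "a + d \<noteq> 0" using Ll tr by auto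
  ultimately show ?thesis using that n(1) Ll by (auto simp: L_def)
qed

lemma unimodular_kernel_semidirect:
  assumes "semidirect br M \<phi>" and "unimodular_kernel br \<noteq> UNIV"
  shows "trace M \<noteq> 0" and "unimodular_kernel br = {X. fst (\<phi> X) = 0}"
  using assms(2) by (auto simp: unimodular_kernel_def semidirect.trace_br[OF assms(1)])

text \<open>In the adapted frame b = 0 makes the bracket of \<open>l\<close> and \<open>n\<close> a
  multiple of \<open>n\<close>, so the plane component of \<open>n\<close> is a real eigenvector of
  M.\<close>

lemma generalized_einstein_degenerate:
  fixes br :: "'a::euclidean_space \<Rightarrow> 'a \<Rightarrow> 'a"
  assumes dim: "DIM('a) = 3" and lie: "lie_bracket br" and nonuni: "unimodular_kernel br \<noteq> UNIV"
    and sd: "semidirect br M \<phi>" and E: "generalized_einstein br H g \<delta>"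
    and deg: "degenerate_on g (unimodular_kernel br)"
  shows "has_real_eigenvalues M" "H X Y Z = 0" "\<exists>v. \<delta> v \<noteq> 0"
proof -
  interpret metric_algebra br g H
    using lie E by unfold_locales (auto simp: lie_bracket_def generalized_einstein_def)
  interpret semidirect br M \<phi> by (rule sd)
  note kernel = unimodular_kernel_semidirect[OF sd nonuni]
  obtain l n e \<epsilon> a b c d h where frame: "null_frame br g H l n e \<epsilon> a b c d h" and ad: "a + d \<noteq> 0"
    and n: "fst (\<phi> n) = 0" and l: "fst (\<phi> l) \<noteq> 0"
    using ex_null_frame[OF sd dim kernel(1) deg[unfolded kernel(2)]] by blast
  interpret F: null_frame br g H l n e \<epsilon> a b c d h by (rule frame)
  have lin: "linear \<delta>" and eq: "\<And>X Y. \<delta> (lift g (nabla br g H X Y))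
      = trace_on UNIV (\<lambda>Z. nabla br g H (nabla br g (- H) Z X) Y)"
    using E generalized_einstein_iff[of \<delta>] dim by auto
  have "linear (\<lambda>X. \<delta> (lift g X))"
    using linear_compose[OF linear_lift lin] by (simp add: o_def)
  note res = F.einstein_frame[OF this ad eq]
  show "H X Y Z = 0" by (rule F.H_eq_0[OF res(2)])
  show "\<exists>v. \<delta> v \<noteq> 0" using res(3) by blast
  show "has_real_eigenvalues M"
  proof (rule real_eigenvector_imp_has_real_eigenvalues)
    have "n \<noteq> 0" using F.g_ln by (auto simp: zero_r)
    then show "snd (\<phi> n) \<noteq> 0"
      by (metis n \<psi>\<phi> linear_0[OF linear_\<psi>] prod.collapse zero_prod_def)
    have "fst (\<phi> l) *\<^sub>R (M *v snd (\<phi> n)) = snd (\<phi> (br l n))"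
      by (simp add: hom semidirect_bracket_def split_beta n)
    also have "\<dots> = a *\<^sub>R snd (\<phi> n)" by (simp add: F.br_ln res(1) linear_scale[OF linear_\<phi>])
    finally have "inverse (fst (\<phi> l)) *\<^sub>R fst (\<phi> l) *\<^sub>R (M *v snd (\<phi> n))
        = inverse (fst (\<phi> l)) *\<^sub>R a *\<^sub>R snd (\<phi> n)" by simp
    then show "M *v snd (\<phi> n) = (a / fst (\<phi> l)) *\<^sub>R snd (\<phi> n)"
      using l by (simp add: divide_inverse mult.commute)
  qed
qed

text \<open>The metric is designed so that an eigenvector for a non-zero eigenvalue becomes the
  vector \<open>n\<close> of a null frame with b = h = 0.\<close>

lemma ex_generalized_einstein_degenerate:
  fixes br :: "'a::euclidean_space \<Rightarrow> 'a \<Rightarrow> 'a"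
  assumes dim: "DIM('a) = 3" and lie: "lie_bracket br" and nonuni: "unimodular_kernel br \<noteq> UNIV"
    and sd: "semidirect br M \<phi>" and M: "has_real_eigenvalues M"
  shows "\<exists>H g \<delta>. generalized_einstein br H g \<delta> \<and> degenerate_on g (unimodular_kernel br)"
proof -
  interpret semidirect br M \<phi> by (rule sd)
  note kernel = unimodular_kernel_semidirect[OF sd nonuni]
  obtain r v0 where r: "r \<noteq> 0" and v0: "v0 \<noteq> 0" "M *v v0 = r *\<^sub>R v0"
    by (rule has_real_eigenvalues_imp_eigenvector[OF M kernel(1)])
  define v where "v = v0 /\<^sub>R norm v0"
  have v: "v \<bullet> v = 1" "M *v v = r *\<^sub>R v"
    using v0 by (simp_all add: v_def dot_square_norm power2_eq_square matrix_vector_mult_scaleR)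
  \<comment> \<open>The rotation of \<open>v\<close> by a right angle, completing it to an
    orthonormal basis of the plane.\<close>
  define w :: "real^2" where "w = vector [- (v $ 2), v $ 1]"
  have w: "w \<bullet> w = 1" "v \<bullet> w = 0" "w \<bullet> v = 0"
    using v(1) by (simp_all add: w_def inner_vec_def sum_2 add.commute)
  have vw: "x = (x \<bullet> v) *\<^sub>R v + (x \<bullet> w) *\<^sub>R w" for x
  proof -
    have 1: "v $ 1 * v $ 1 + v $ 2 * v $ 2 = 1" using v(1) by (simp add: inner_vec_def sum_2)
    have "x $ 1 = (x \<bullet> v) * v $ 1 - (x \<bullet> w) * v $ 2 \<longleftrightarrow> x $ 1 = x $ 1 * (v $ 1 * v $ 1 + v $ 2 * v $ 2)"
      "x $ 2 = (x \<bullet> v) * v $ 2 + (x \<bullet> w) * v $ 1 \<longleftrightarrow> x $ 2 = x $ 2 * (v $ 1 * v $ 1 + v $ 2 * v $ 2)"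
      by (simp_all add: inner_vec_def sum_2 w_def algebra_simps)
    then show ?thesis unfolding 1 by (simp add: vec_eq_iff forall_2 w_def)
  qed
  define l n e where "l = \<psi> (1, 0)" and "n = \<psi> (0, v)" and "e = \<psi> (0, w)"
  have \<phi>: "\<phi> l = (1, 0)" "\<phi> n = (0, v)" "\<phi> e = (0, w)" by (simp_all add: l_def n_def e_def \<phi>\<psi>)
  \<comment> \<open>The factor \<open>real\<close> and \<open>v\<close> form a hyperbolic plane,
    orthogonal to the unit vector \<open>w\<close>; this makes \<open>l\<close>, \<open>n\<close>,
    \<open>e\<close> a null frame with sign 1.\<close>
  define g where "g X Y = fst (\<phi> X) * (snd (\<phi> Y) \<bullet> v) + (snd (\<phi> X) \<bullet> v) * fst (\<phi> Y)
      + (snd (\<phi> X) \<bullet> w) * (snd (\<phi> Y) \<bullet> w)" for X Y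
  have "bilinear g"
    unfolding bilinear_def
    by (intro conjI allI; rule linearI)
      (simp_all add: g_def linear_add[OF linear_\<phi>] linear_scale[OF linear_\<phi>] inner_add_left algebra_simps)
  moreover have "X = 0" if X: "\<And>Y. g X Y = 0" for X
  proof -
    have "fst (\<phi> X) = 0" "snd (\<phi> X) \<bullet> v = 0" "snd (\<phi> X) \<bullet> w = 0"
      using X[of l] X[of n] X[of e] by (simp_all add: g_def \<phi> v w)
    then have "\<phi> X = 0" using vw[of "snd (\<phi> X)"] by (simp add: prod_eq_iff)
    then show ?thesis by (metis \<psi>\<phi> linear_0[OF linear_\<psi>])
  qed
  ultimately have pm: "pseudo_metric g"
    by (auto simp: pseudo_metric_def g_def algebra_simps)
  define H :: "'a \<Rightarrow> 'a \<Rightarrow> 'a \<Rightarrow> real" where "H X Y Z = 0" for X Y Z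
  have H: "three_form H" "- H = H"
    by (auto simp: three_form_def H_def fun_eq_iff linear_zero)
  define c where "c = (M *v w) \<bullet> v"
  define d where "d = (M *v w) \<bullet> w"
  interpret F: null_frame br g H l n e 1 r 0 c d 0
  proof unfold_locales
    show "br l n = r *\<^sub>R n + (2 * 0) *\<^sub>R e"
      unfolding br_eq \<phi> by (simp add: v n_def flip: linear_scale[OF linear_\<psi>])
    have "(0, M *v w) = c *\<^sub>R (0::real, v) + d *\<^sub>R (0, w)"
      using vw[of "M *v w"] by (simp add: c_def d_def)
    then show "br l e = c *\<^sub>R n + d *\<^sub>R e"
      unfolding br_eq \<phi> by (simp add: n_def e_def flip: linear_scale[OF linear_\<psi>] linear_add[OF linear_\<psi>])
    show "br n e = 0" by (rule br_kernel) (simp_all add: \<phi>)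
  qed (use lie dim pm H in \<open>auto simp: lie_bracket_def g_def \<phi> v w H_def\<close>)
  \<comment> \<open>The solution of the equation for the pair (l, l); it exists because the
    eigenvalue \<open>r\<close> is non-zero.\<close>
  define \<alpha> where "\<alpha> = - (r * r + d * d) / r"
  define \<delta> where "\<delta> u = \<alpha> * g (fst u) n" for u :: "'a gen"
  have "linear \<delta>"
    by (rule linearI) (simp_all add: \<delta>_def F.g_simps algebra_simps)
  moreover have "\<alpha> * g (nabla br g H X Y) n = trace_on UNIV (\<lambda>Z. nabla br g H (nabla br g (- H) Z X) Y)" for X Y
    by (rule F.einstein_frame_exists) (simp_all add: \<alpha>_def r)
  \<comment> \<open>Since \<open>- H = H\<close> and \<delta> sees only the vector component, which
    both lifts share, the two Einstein equations coincide.\<close>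
  ultimately have "generalized_einstein br H g \<delta>"
    using dim by (simp add: F.generalized_einstein_iff H \<delta>_def F.fst_lift lift_def)
  moreover have "degenerate_on g (unimodular_kernel br)"
    unfolding degenerate_on_def kernel(2)
  proof (rule bexI[of _ n])
    have "n \<noteq> 0" using F.g_ln by (auto simp: F.zero_r)
    then show "n \<noteq> 0 \<and> (\<forall>Y\<in>{X. fst (\<phi> X) = 0}. g n Y = 0)" by (simp add: \<phi> g_def w)
  qed (simp add: \<phi>)
  ultimately show ?thesis by blast
qed

theorem proposition3p16:
  fixes br :: "'a::euclidean_space \<Rightarrow> 'a \<Rightarrow> 'a"
  assumes "DIM('a) = 3"
    and "lie_bracket br"
    and "unimodular_kernel br \<noteq> UNIV"
  shows "(\<exists>M::real^2^2. trace M \<noteq> 0 \<and> lie_isomorphic br (semidirect_bracket M)) \<and>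
    (\<forall>M::real^2^2. lie_isomorphic br (semidirect_bracket M) \<longrightarrow>
       trace M \<noteq> 0 \<and>
       ((\<exists>H g \<delta>. generalized_einstein br H g \<delta> \<and> degenerate_on g (unimodular_kernel br))
          \<longleftrightarrow> has_real_eigenvalues M)) \<and>
    (\<forall>H g \<delta>. generalized_einstein br H g \<delta> \<and> degenerate_on g (unimodular_kernel br) \<longrightarrow>
       (\<forall>X Y Z. H X Y Z = 0) \<and> (\<exists>v. \<delta> v \<noteq> 0))"
proof -
  obtain M0 \<phi>0 where sd: "semidirect br M0 \<phi>0"
    using ex_lie_isomorphic_semidirect[OF assms] by (auto simp: lie_isomorphic_semidirect_iff)
  show ?thesis
  proof (intro conjI allI impI)
    show "\<exists>M::real^2^2. trace M \<noteq> 0 \<and> lie_isomorphic br (semidirect_bracket M)"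
      using sd unimodular_kernel_semidirect(1)[OF sd assms(3)] by (auto simp: lie_isomorphic_semidirect_iff)
    show "trace M \<noteq> 0" if "lie_isomorphic br (semidirect_bracket M)" for M
      using that unimodular_kernel_semidirect(1)[OF _ assms(3)] by (auto simp: lie_isomorphic_semidirect_iff)
    show "(\<exists>H g \<delta>. generalized_einstein br H g \<delta> \<and> degenerate_on g (unimodular_kernel br))
          \<longleftrightarrow> has_real_eigenvalues M" if "lie_isomorphic br (semidirect_bracket M)" for M
      using that generalized_einstein_degenerate(1)[OF assms]
        ex_generalized_einstein_degenerate[OF assms] by (auto simp: lie_isomorphic_semidirect_iff)
    show "H X Y Z = 0" if "generalized_einstein br H g \<delta> \<and> degenerate_on g (unimodular_kernel br)"
      for H g \<delta> X Y Z
      using that generalized_einstein_degenerate(2)[OF assms sd] by blast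
    show "\<exists>v. \<delta> v \<noteq> 0" if "generalized_einstein br H g \<delta> \<and> degenerate_on g (unimodular_kernel br)"
      for H g \<delta>
      using that generalized_einstein_degenerate(3)[OF assms sd] by blast
  qed
qed

end
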